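(* Let $k$ be a field, let $n\ge 1$, and let $Q$ be a quiver of type $\mathbb{A}_n$ (with arbitrary orientation). Then every (not necessarily finite-dimensional) representation of $Q$ over $k$ is isomorphic to a direct sum of thin indecomposable representations of $Q$.
   Context: A quiver $Q=(Q_0,Q_1,s,t)$ is finite. A representation $M$ of $Q$ consists of $k$-vector spaces $M_x$ ($x\in Q_0$), possibly infinite-dimensional, and linear maps $M_\alpha: M_{s(\alpha)}\to M_{t(\alpha)}$ ($\alpha\in Q_1$). A quiver is of type $\mathbb{A}_n$ if its underlying graph is the path with $n$ vertices $1 - 2 - \cdots - n$. A representation $M$ is thin if $\dim_k M_x\le 1$ for all vertices $x$. A representation is indecomposable if it is nonzero and not a direct sum of two nonzero representations. Direct sums may be infinite. *)

theory Defs
  imports "Jordan_Normal_Form.Missing_VectorSpace" "Graph_Theory.Digraph"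
begin

text \<open>
  A quiver is a finite directed multigraph (\<^locale>\<open>fin_digraph\<close>), with \<^const>\<open>tail\<close> the source
  and \<^const>\<open>head\<close> the target of an arrow.
\<close>

text \<open>
  The vertices are \<open>p 1, \<dots>, p n\<close> and the arrows are \<open>e 1, \<dots>, e (n - 1)\<close>, without repetition;
  the arrow \<open>e i\<close> joins \<open>p i\<close> and \<open>p (i + 1)\<close>, in either direction.
\<close>

definition type_A :: "nat \<Rightarrow> ('q0, 'q1) pre_digraph \<Rightarrow> bool" where
  "type_A n Q \<longleftrightarrow> fin_digraph Q \<and>
     (\<exists>p e. bij_betw p {1..n} (verts Q) \<and> bij_betw e {1..<n} (arcs Q) \<and>
       (\<forall>i\<in>{1..<n}. {tail Q (e i), head Q (e i)} = {p i, p (i + 1)}))"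

record ('q0, 'q1, 'k, 'a) quiver_rep =
  vspace :: "'q0 \<Rightarrow> ('k, 'a) module"
  vmap :: "'q1 \<Rightarrow> 'a \<Rightarrow> 'a"

definition is_rep ::
  "('k, 'm) ring_scheme \<Rightarrow> ('q0, 'q1) pre_digraph \<Rightarrow> ('q0, 'q1, 'k, 'a) quiver_rep \<Rightarrow> bool" where
  "is_rep K Q M \<longleftrightarrow>
     (\<forall>x\<in>verts Q. vectorspace K (vspace M x)) \<and>
     (\<forall>\<alpha>\<in>arcs Q. linear_map K (vspace M (tail Q \<alpha>)) (vspace M (head Q \<alpha>)) (vmap M \<alpha>))"

definition rep_iso ::
  "('k, 'm) ring_scheme \<Rightarrow> ('q0, 'q1) pre_digraph \<Rightarrow>
   ('q0, 'q1, 'k, 'a) quiver_rep \<Rightarrow> ('q0, 'q1, 'k, 'b) quiver_rep \<Rightarrow> bool" where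
  "rep_iso K Q M N \<longleftrightarrow>
     (\<exists>\<phi>. (\<forall>x\<in>verts Q. linear_map K (vspace M x) (vspace N x) (\<phi> x) \<and>
                        bij_betw (\<phi> x) (carrier (vspace M x)) (carrier (vspace N x))) \<and>
          (\<forall>\<alpha>\<in>arcs Q. \<forall>v\<in>carrier (vspace M (tail Q \<alpha>)).
             \<phi> (head Q \<alpha>) (vmap M \<alpha> v) = vmap N \<alpha> (\<phi> (tail Q \<alpha>) v)))"

text \<open>
  The external direct sum of a family of modules: finitely supported families, represented by
  functions that are \<^const>\<open>undefined\<close> outside \<open>I\<close>. The fields \<^const>\<open>mult\<close> and \<^const>\<open>one\<close> are
  only present because module records extend ring records; no module axiom mentions them.
\<close>

definition module_dsum :: "'i set \<Rightarrow> ('i \<Rightarrow> ('k, 'a) module) \<Rightarrow> ('k, 'i \<Rightarrow> 'a) module" where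
  "module_dsum I V =
     \<lparr>carrier = {f \<in> (\<Pi>\<^sub>E i\<in>I. carrier (V i)). finite {i \<in> I. f i \<noteq> \<zero>\<^bsub>V i\<^esub>}},
      mult = (\<lambda>f g. undefined),
      one = undefined,
      zero = (\<lambda>i\<in>I. \<zero>\<^bsub>V i\<^esub>),
      add = (\<lambda>f g. \<lambda>i\<in>I. f i \<oplus>\<^bsub>V i\<^esub> g i),
      smult = (\<lambda>c f. \<lambda>i\<in>I. c \<odot>\<^bsub>V i\<^esub> f i)\<rparr>"

definition rep_dsum ::
  "'i set \<Rightarrow> ('i \<Rightarrow> ('q0, 'q1, 'k, 'a) quiver_rep) \<Rightarrow> ('q0, 'q1, 'k, 'i \<Rightarrow> 'a) quiver_rep" where
  "rep_dsum I N =
     \<lparr>vspace = (\<lambda>x. module_dsum I (\<lambda>i. vspace (N i) x)),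
      vmap = (\<lambda>\<alpha> f. \<lambda>i\<in>I. vmap (N i) \<alpha> (f i))\<rparr>"

text \<open>\<^const>\<open>vectorspace.dim\<close> is meaningful only under \<^const>\<open>vectorspace.fin_dim\<close>.\<close>

definition thin ::
  "('k, 'm) ring_scheme \<Rightarrow> ('q0, 'q1) pre_digraph \<Rightarrow> ('q0, 'q1, 'k, 'a) quiver_rep \<Rightarrow> bool" where
  "thin K Q M \<longleftrightarrow>
     (\<forall>x\<in>verts Q. vectorspace.fin_dim K (vspace M x) \<and> vectorspace.dim K (vspace M x) \<le> 1)"

definition nonzero_rep ::
  "('q0, 'q1) pre_digraph \<Rightarrow> ('q0, 'q1, 'k, 'a) quiver_rep \<Rightarrow> bool" where
  "nonzero_rep Q M \<longleftrightarrow> (\<exists>x\<in>verts Q. carrier (vspace M x) \<noteq> {\<zero>\<^bsub>vspace M x\<^esub>})"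

text \<open>
  It is no restriction that \<open>N1\<close> and \<open>N2\<close> have the element type of \<open>M\<close>: summands over any other type
  are isomorphic to subrepresentations of \<open>M\<close>.
\<close>

definition indecomposable ::
  "('k, 'm) ring_scheme \<Rightarrow> ('q0, 'q1) pre_digraph \<Rightarrow> ('q0, 'q1, 'k, 'a) quiver_rep \<Rightarrow> bool" where
  "indecomposable K Q M \<longleftrightarrow> nonzero_rep Q M \<and>
     \<not> (\<exists>N1 N2 :: ('q0, 'q1, 'k, 'a) quiver_rep.
          is_rep K Q N1 \<and> is_rep K Q N2 \<and> nonzero_rep Q N1 \<and> nonzero_rep Q N2 \<and>
          rep_iso K Q M (rep_dsum UNIV (case_bool N1 N2)))"

lemma vectorspace_module_dsum:
  assumes "field K" "\<And>i. i \<in> I \<Longrightarrow> vectorspace K (V i)"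
  shows "vectorspace K (module_dsum I V)"
proof -
  interpret K: field K by fact
  note md = vectorspace.axioms(1)[OF assms(2)]
  note gr = module.axioms(2)[OF md]
  have supp: "finite {i \<in> I. h i \<noteq> \<zero>\<^bsub>V i\<^esub>}"
    if "finite {i \<in> I. f i \<noteq> \<zero>\<^bsub>V i\<^esub>}" "finite {i \<in> I. g i \<noteq> \<zero>\<^bsub>V i\<^esub>}"
      "\<And>i. i \<in> I \<Longrightarrow> f i = \<zero>\<^bsub>V i\<^esub> \<Longrightarrow> g i = \<zero>\<^bsub>V i\<^esub> \<Longrightarrow> h i = \<zero>\<^bsub>V i\<^esub>" for f g h
    by (rule finite_subset[OF _ finite_UnI[OF that(1,2)]]) (use that(3) in blast)
  have z: "\<zero>\<^bsub>V i\<^esub> \<in> carrier (V i)" if "i \<in> I" for i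
    using abelian_monoid.zero_closed[OF abelian_group.axioms(1)[OF gr[OF that]]] .
  have ac: "a \<oplus>\<^bsub>V i\<^esub> b \<in> carrier (V i)" if "i \<in> I" "a \<in> carrier (V i)" "b \<in> carrier (V i)" for i a b
    using abelian_monoid.a_closed[OF abelian_group.axioms(1)[OF gr[OF that(1)]]] that by blast
  have zz: "\<zero>\<^bsub>V i\<^esub> \<oplus>\<^bsub>V i\<^esub> a = a" if "i \<in> I" "a \<in> carrier (V i)" for i a
    using abelian_monoid.l_zero[OF abelian_group.axioms(1)[OF gr[OF that(1)]]] that by blast
  have sc: "c \<odot>\<^bsub>V i\<^esub> a \<in> carrier (V i)" if "i \<in> I" "c \<in> carrier K" "a \<in> carrier (V i)" for i c a
    using module.smult_closed[OF md] that by blast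
  have sz: "c \<odot>\<^bsub>V i\<^esub> \<zero>\<^bsub>V i\<^esub> = \<zero>\<^bsub>V i\<^esub>" if "i \<in> I" "c \<in> carrier K" for i c
    using module.smult_r_null[OF md] that by blast
  have mz: "\<ominus>\<^bsub>V i\<^esub> \<zero>\<^bsub>V i\<^esub> = \<zero>\<^bsub>V i\<^esub>" if "i \<in> I" for i
    using abelian_group.r_neg[OF gr z] zz[OF that abelian_group.a_inv_closed[OF gr z]] that by simp
  have "abelian_group (module_dsum I V)"
  proof (rule abelian_groupI, goal_cases)
    case (1 f g)
    have "finite {i \<in> I. (\<lambda>i\<in>I. f i \<oplus>\<^bsub>V i\<^esub> g i) i \<noteq> \<zero>\<^bsub>V i\<^esub>}"
      by (rule supp[of f g]) (use 1 z zz in \<open>auto simp: module_dsum_def\<close>)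
    with 1 show ?case by (auto simp: module_dsum_def intro!: ac)
  next
    case 2
    have "{i \<in> I. (\<lambda>i\<in>I. \<zero>\<^bsub>V i\<^esub>) i \<noteq> \<zero>\<^bsub>V i\<^esub>} = {}" by auto
    then show ?case using z by (auto simp: module_dsum_def)
  next
    case (3 f g h)
    then show ?case
      by (auto simp: module_dsum_def PiE_iff intro!: restrict_ext abelian_monoid.a_assoc[OF abelian_group.axioms(1)[OF gr]])
  next
    case (4 f g)
    then show ?case
      by (auto simp: module_dsum_def PiE_iff intro!: restrict_ext abelian_monoid.a_comm[OF abelian_group.axioms(1)[OF gr]])
  next
    case (5 f)
    then show ?case
      by (auto simp: module_dsum_def PiE_iff extensional_def restrict_def zz fun_eq_iff)
  next
    case (6 f)
    let ?g = "\<lambda>i\<in>I. \<ominus>\<^bsub>V i\<^esub> f i"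
    have "finite {i \<in> I. ?g i \<noteq> \<zero>\<^bsub>V i\<^esub>}"
      by (rule supp[of f f]) (use 6 mz in \<open>auto simp: module_dsum_def\<close>)
    then show ?case using 6
      by (intro bexI[of _ ?g])
         (auto simp: module_dsum_def PiE_iff intro!: restrict_ext abelian_group.l_neg[OF gr] abelian_group.a_inv_closed[OF gr])
  qed
  moreover have "module_axioms K (module_dsum I V)"
  proof (rule module_axioms.intro, goal_cases)
    case (1 c f)
    have "finite {i \<in> I. (\<lambda>i\<in>I. c \<odot>\<^bsub>V i\<^esub> f i) i \<noteq> \<zero>\<^bsub>V i\<^esub>}"
      by (rule supp[of f f]) (use 1 sz in \<open>auto simp: module_dsum_def\<close>)
    with 1 show ?case by (auto simp: module_dsum_def intro!: sc)
  qed (auto simp: module_dsum_def PiE_iff fun_eq_iff extensional_def restrict_def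
        module.smult_l_distr[OF md] module.smult_r_distr[OF md] module.smult_assoc1[OF md] module.smult_one[OF md])
  ultimately show ?thesis
    using K.is_cring assms(1) by (simp add: vectorspace_def Module.module_def)
qed

lemma is_rep_dsum:
  assumes "field K" "wf_digraph Q" "\<And>i. i \<in> I \<Longrightarrow> is_rep K Q (N i)"
  shows "is_rep K Q (rep_dsum I N)"
proof -
  interpret Q: wf_digraph Q by fact
  have vs: "vectorspace K (vspace (rep_dsum I N) x)" if "x \<in> verts Q" for x
    using assms(3) that by (auto simp: rep_dsum_def is_rep_def intro!: vectorspace_module_dsum[OF assms(1)])
  have "linear_map K (vspace (rep_dsum I N) (tail Q \<alpha>)) (vspace (rep_dsum I N) (head Q \<alpha>)) (vmap (rep_dsum I N) \<alpha>)"
    if a: "\<alpha> \<in> arcs Q" for \<alpha>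
  proof -
    have l: "linear_map K (vspace (N i) (tail Q \<alpha>)) (vspace (N i) (head Q \<alpha>)) (vmap (N i) \<alpha>)" if "i \<in> I" for i
      using assms(3)[OF that] a by (simp add: is_rep_def)
    note mh = mod_hom.f_hom[OF linear_map.axioms(3)[OF l], unfolded LinearCombinations.module_hom_def, simplified]
    have z: "vmap (N i) \<alpha> \<zero>\<^bsub>vspace (N i) (tail Q \<alpha>)\<^esub> = \<zero>\<^bsub>vspace (N i) (head Q \<alpha>)\<^esub>" if "i \<in> I" for i
      using mod_hom.f0_is_0[OF linear_map.axioms(3)[OF l[OF that]]] .
    have fin: "finite {i \<in> I. (\<lambda>i\<in>I. vmap (N i) \<alpha> (f i)) i \<noteq> \<zero>\<^bsub>vspace (N i) (head Q \<alpha>)\<^esub>}"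
      if "finite {i \<in> I. f i \<noteq> \<zero>\<^bsub>vspace (N i) (tail Q \<alpha>)\<^esub>}" for f
      by (rule finite_subset[OF _ that]) (use z in auto)
    have "vmap (rep_dsum I N) \<alpha> \<in> LinearCombinations.module_hom K (vspace (rep_dsum I N) (tail Q \<alpha>)) (vspace (rep_dsum I N) (head Q \<alpha>))"
      using mh fin by (fastforce simp: LinearCombinations.module_hom_def rep_dsum_def module_dsum_def PiE_iff intro!: restrict_ext)
    with vs a show ?thesis
      by (simp add: linear_map_def mod_hom_def mod_hom_axioms_def vectorspace.axioms(1))
  qed
  with vs show ?thesis by (simp add: is_rep_def)
qed

end

theory Submission
  imports Defs
begin

text \<open>
  A representation splits into thin pieces as soon as its spaces have bases that are compatible with
  its maps: every arrow sends each basis vector either to zero or to a basis vector, and distinct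
  basis vectors with nonzero image have distinct images. Joining each basis vector to its nonzero
  images then yields strings, each of which meets every vertex at most once and runs over an
  interval of the path. The spans of the strings are thin subrepresentations, and the representation
  is their direct sum. A string is connected through nonzero maps between lines, which makes its span
  indecomposable.

  Compatible bases are built by walking along the path, keeping at the current vertex a finite
  flag of subspaces that records what has happened so far (images and kernels of the maps to the
  left). The invariant is that every basis adapted to this flag, i.e. containing a basis of each of
  its members, is the last member of a compatible family of bases. For an arrow \<open>T\<close> leaving the
  current vertex, the new flag consists of the images of the old one and of the image of the whole
  space (\<open>adapted_basis_along_forward\<close>); for an arrow arriving there, it consists of the
  preimages of the old one and of the kernel (\<open>adapted_basis_along_backward\<close>). In both cases an
  adapted basis at the new vertex is matched with an adapted basis at the old one. Dimensions
  never enter, only the extension of independent sets along a flag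
  (\<open>lin_indpt_extends_along_flag\<close>), which rests on Zorn's lemma.

  To index the summands by pairs of a vertex and a vector, a string is named by its leftmost
  basis vector (\<open>type_A_labelled_bases\<close>).
\<close>

section \<open>Linear independence in arbitrary dimension\<close>

lemma (in vectorspace) lin_indpt_iff_notin_span:
  assumes "S \<subseteq> carrier V"
  shows "lin_indpt S \<longleftrightarrow> (\<forall>v\<in>S. v \<notin> span (S - {v}))"
proof
  assume li: "lin_indpt S"
  show "\<forall>v\<in>S. v \<notin> span (S - {v})"
  proof
    fix v assume v: "v \<in> S"
    then have "S - {v} \<union> {v} = S" by blast
    then show "v \<notin> span (S - {v})"
      using lin_dep_iff_in_span[of "S - {v}" v] subset_li_is_li[OF li] li assms v by auto
  qed
next
  assume *: "\<forall>v\<in>S. v \<notin> span (S - {v})"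
  show "lin_indpt S"
  proof
    assume "lin_dep S"
    then obtain A a v where A: "finite A" "A \<subseteq> S" "a \<in> A \<rightarrow> carrier K" "lincomb a A = \<zero>\<^bsub>V\<^esub>" "v \<in> A" "a v \<noteq> \<zero>\<^bsub>K\<^esub>"
      unfolding lin_dep_def by blast
    then have "v \<in> span (A - {v})" using lincomb_isolate(2) assms by blast
    moreover have "span (A - {v}) \<subseteq> span (S - {v})"
      using A by (intro span_is_monotone) auto
    ultimately show False using * A by blast
  qed
qed

lemma (in vectorspace) lin_indpt_Un:
  assumes X: "X \<subseteq> carrier V" "lin_indpt X" and Y: "Y \<subseteq> carrier V" "lin_indpt Y"
    and XY: "span X \<inter> span Y \<subseteq> {\<zero>\<^bsub>V\<^esub>}"
  shows "lin_indpt (X \<union> Y)"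
proof
  assume "lin_dep (X \<union> Y)"
  then obtain A a v where A: "finite A" "A \<subseteq> X \<union> Y" "a \<in> A \<rightarrow> carrier K" "lincomb a A = \<zero>\<^bsub>V\<^esub>" "v \<in> A" "a v \<noteq> \<zero>\<^bsub>K\<^esub>"
    unfolding lin_dep_def by blast
  define A1 where "A1 = A \<inter> X"
  define A2 where "A2 = A - X"
  have fin: "finite A1" "finite A2" and sub: "A1 \<subseteq> X" "A2 \<subseteq> Y"
    and a: "a \<in> A1 \<rightarrow> carrier K" "a \<in> A2 \<rightarrow> carrier K"
    using A by (auto simp: A1_def A2_def)
  have AV: "A \<subseteq> carrier V" using A(2) X Y by blast
  have "A = A1 \<union> A2" "A1 \<inter> A2 = {}" by (auto simp: A1_def A2_def)
  then have sum: "lincomb a A1 \<oplus>\<^bsub>V\<^esub> lincomb a A2 = \<zero>\<^bsub>V\<^esub>"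
    using module.lincomb_union[of A1 A2 a] A AV by simp
  have c: "lincomb a A1 \<in> carrier V" "lincomb a A2 \<in> carrier V"
    using lincomb_closed[of A1 a] lincomb_closed[of A2 a] sub X(1) Y(1) a by blast+
  have s: "lincomb a A1 \<in> span X" "lincomb a A2 \<in> span Y"
    using fin sub a unfolding span_def by blast+
  have eq: "lincomb a A1 = \<ominus>\<^bsub>V\<^esub> lincomb a A2"
    using M.minus_equality[OF sum c(2,1)] by (rule sym)
  then have "lincomb a A1 \<in> span Y" using s(2) span_neg Y by simp
  then have z1: "lincomb a A1 = \<zero>\<^bsub>V\<^esub>" using s XY by blast
  then have z2: "lincomb a A2 = \<zero>\<^bsub>V\<^esub>" using sum c(2) by (simp only: M.l_zero)
  have "v \<in> A1 \<or> v \<in> A2" using A by (auto simp: A1_def A2_def)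
  then show False
    using lin_dep_crit[OF fin(1) sub(1) a(1) _ A(6) z1] lin_dep_crit[OF fin(2) sub(2) a(2) _ A(6) z2] X Y
    by blast
qed

lemma (in vectorspace) span_disjoint_Int:
  assumes "lin_indpt S" "S \<subseteq> carrier V" "X \<subseteq> S" "Y \<subseteq> S" "X \<inter> Y = {}"
  shows "span X \<inter> span Y \<subseteq> {\<zero>\<^bsub>V\<^esub>}"
proof
  fix z assume "z \<in> span X \<inter> span Y"
  then obtain a A b B where A: "finite A" "A \<subseteq> X" "a \<in> A \<rightarrow> carrier K" "z = lincomb a A"
    and B: "finite B" "B \<subseteq> Y" "b \<in> B \<rightarrow> carrier K" "z = lincomb b B"
    unfolding span_def by blast
  have AV: "A \<subseteq> carrier V" and BV: "B \<subseteq> carrier V" using A(2) B(2) assms by auto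
  have zc: "z \<in> carrier V" using A(3,4) AV by simp
  have neg: "(\<lambda>v. (\<ominus>\<^bsub>K\<^esub> \<one>\<^bsub>K\<^esub>) \<otimes>\<^bsub>K\<^esub> b v) \<in> B \<rightarrow> carrier K" using B(3) by (simp add: Pi_def)
  define c where "c = (\<lambda>v. if v \<in> A then a v else (\<ominus>\<^bsub>K\<^esub> \<one>\<^bsub>K\<^esub>) \<otimes>\<^bsub>K\<^esub> b v)"
  have "lincomb (\<lambda>v. (\<ominus>\<^bsub>K\<^esub> \<one>\<^bsub>K\<^esub>) \<otimes>\<^bsub>K\<^esub> b v) B = (\<ominus>\<^bsub>K\<^esub> \<one>\<^bsub>K\<^esub>) \<odot>\<^bsub>V\<^esub> z"
    using lincomb_smult[OF BV B(3)] B by simp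
  also have "\<dots> = \<ominus>\<^bsub>V\<^esub> z" using zc by (simp add: smult_minus_1)
  finally have "lincomb a A \<oplus>\<^bsub>V\<^esub> lincomb (\<lambda>v. (\<ominus>\<^bsub>K\<^esub> \<one>\<^bsub>K\<^esub>) \<otimes>\<^bsub>K\<^esub> b v) B = \<zero>\<^bsub>V\<^esub>"
    using zc A(4) by (simp add: M.r_neg)
  moreover have "lincomb a A \<oplus>\<^bsub>V\<^esub> lincomb (\<lambda>v. (\<ominus>\<^bsub>K\<^esub> \<one>\<^bsub>K\<^esub>) \<otimes>\<^bsub>K\<^esub> b v) B = lincomb c (A \<union> B)"
    unfolding c_def using A(1-3) B(1) AV BV neg assms(5) A(2) B(2) by (intro lincomb_union2) blast+
  ultimately have "lincomb c (A \<union> B) = \<zero>\<^bsub>V\<^esub>" by simp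
  moreover have "c \<in> A \<union> B \<rightarrow> carrier K" using A(3) neg by (simp add: c_def Pi_def)
  ultimately have "c \<in> A \<union> B \<rightarrow> {\<zero>\<^bsub>K\<^esub>}"
    using not_lindepD[OF assms(1), of "A \<union> B" c] A(1,2) B(1,2) assms(3,4) by blast
  then have "a \<in> A \<rightarrow> {\<zero>\<^bsub>K\<^esub>}" by (simp add: c_def Pi_def)
  then show "z \<in> {\<zero>\<^bsub>V\<^esub>}" using lincomb_zero[OF AV] A(4) by simp
qed

text \<open>
  Zorn's lemma, applied to the independent sets between \<open>C\<close> and \<open>W\<close>. A linear dependency
  involves finitely many vectors, so a dependency in the union of a chain already occurs in a
  member of the chain.
\<close>

lemma (in vectorspace) lin_indpt_extends_within:
  assumes C: "lin_indpt C" "C \<subseteq> W" and W: "W \<subseteq> carrier V"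
  obtains B where "C \<subseteq> B" "B \<subseteq> W" "lin_indpt B" "W \<subseteq> span B"
proof -
  let ?P = "{B. C \<subseteq> B \<and> B \<subseteq> W \<and> lin_indpt B}"
  have "\<exists>B\<in>?P. \<forall>X\<in>?P. B \<subseteq> X \<longrightarrow> X = B"
  proof (rule subset_Zorn_nonempty)
    show "?P \<noteq> {}" using C by blast
    fix Ch assume ne: "Ch \<noteq> {}" and ch: "subset.chain ?P Ch"
    have mem: "B \<in> ?P" if "B \<in> Ch" for B using ch that by (auto simp: subset.chain_def)
    have "lin_indpt (\<Union>Ch)"
    proof
      assume "lin_dep (\<Union>Ch)"
      then obtain A a v where A: "finite A" "A \<subseteq> \<Union>Ch" "a \<in> A \<rightarrow> carrier K" "lincomb a A = \<zero>\<^bsub>V\<^esub>" "v \<in> A" "a v \<noteq> \<zero>\<^bsub>K\<^esub>"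
        unfolding lin_dep_def by blast
      obtain B where B: "B \<in> Ch" "A \<subseteq> B"
        using finite_subset_Union_chain[OF A(1,2) ne ch] by blast
      have "lin_dep B" by (rule lin_dep_crit[OF A(1) B(2) A(3,5,6,4)])
      then show False using mem[OF B(1)] by blast
    qed
    then show "\<Union>Ch \<in> ?P" using mem ne by blast
  qed
  then obtain B where "B \<in> ?P" and max: "\<forall>X\<in>?P. B \<subseteq> X \<longrightarrow> X = B" by (rule bexE)
  then have B: "C \<subseteq> B" "B \<subseteq> W" "lin_indpt B" by simp_all
  have "W \<subseteq> span B"
  proof
    fix w assume w: "w \<in> W"
    show "w \<in> span B"
    proof (cases "w \<in> B")
      case True
      then show ?thesis using in_own_span[of B] B W by blast
    next
      case False
      then have "lin_dep (B \<union> {w})" using max B(1,2) w by blast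
      then show ?thesis using lin_dep_iff_in_span[of B w] B W w False by blast
    qed
  qed
  then show ?thesis using that B by blast
qed

section \<open>Linear maps, spans and independent sets\<close>

lemma (in vectorspace) submodule_diff_closed:
  assumes F: "submodule K F V" and vw: "v \<in> F" "w \<in> F"
  shows "v \<ominus>\<^bsub>V\<^esub> w \<in> F"
proof -
  have "w \<in> carrier V" using submodule.subset[OF F] vw by blast
  then have "\<ominus>\<^bsub>V\<^esub> w \<in> F"
    using submodule.smult_closed[OF F _ vw(2), of "\<ominus>\<^bsub>K\<^esub> \<one>\<^bsub>K\<^esub>"] by (simp add: smult_minus_1)
  then show ?thesis using submodule.m_closed[OF F vw(1)] by (simp add: a_minus_def)
qed

context mod_hom
begin

lemma vimage_submodule:
  assumes F: "submodule R F N"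
  shows "submodule R {v \<in> carrier M. f v \<in> F} M"
proof (rule submodule.intro[OF M.module_axioms], goal_cases)
  case 1 show ?case by blast
next
  case (2 v w) then show ?case using submodule.m_closed[OF F, of "f v" "f w"] by simp
next
  case 3 show ?case using submodule.zero_closed[OF F] by simp
next
  case (4 c v) then show ?case using submodule.smult_closed[OF F, of c "f v"] by simp
qed

lemma image_submodule:
  assumes F: "submodule R F M"
  shows "submodule R (f ` F) N"
proof (rule submodule.intro[OF N.module_axioms], goal_cases)
  case 1 show ?case using submodule.subset[OF F] by blast
next
  case (2 v w)
  then obtain a b where ab: "a \<in> F" "b \<in> F" "v = f a" "w = f b" by blast
  then have "v \<oplus>\<^bsub>N\<^esub> w = f (a \<oplus>\<^bsub>M\<^esub> b)"
    using submodule.subset[OF F] by (simp add: subset_iff)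
  then show ?case using submodule.m_closed[OF F ab(1,2)] by simp
next
  case 3 show ?case using submodule.zero_closed[OF F] f0_is_0 by (metis imageI)
next
  case (4 c v)
  then obtain a where a: "a \<in> F" "v = f a" by blast
  then have "c \<odot>\<^bsub>N\<^esub> v = f (c \<odot>\<^bsub>M\<^esub> a)"
    using submodule.subset[OF F] 4(1) by (simp add: subset_iff)
  then show ?case using submodule.smult_closed[OF F 4(1) a(1)] by simp
qed

lemma image_span:
  assumes S: "S \<subseteq> carrier M"
  shows "f ` M.span S = N.span (f ` S)"
proof
  have fS: "f ` S \<subseteq> carrier N" using S by auto
  have "M.span S \<subseteq> {v \<in> carrier M. f v \<in> N.span (f ` S)}"
    using S N.in_own_span[OF fS]
    by (intro M.span_is_subset vimage_submodule N.span_is_submodule fS) auto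
  then show "f ` M.span S \<subseteq> N.span (f ` S)" by blast
  show "N.span (f ` S) \<subseteq> f ` M.span S"
    using M.in_own_span[OF S]
    by (intro N.span_is_subset image_submodule M.span_is_submodule S) auto
qed

end

context linear_map
begin

lemma lincomb_image:
  assumes "finite A" "A \<subseteq> carrier V" "inj_on T A" "a \<in> A \<rightarrow> carrier K"
  shows "T (V.module.lincomb a A) = W.module.lincomb (a \<circ> the_inv_into A T) (T ` A)"
proof -
  have "T (V.module.lincomb a A) = (\<Oplus>\<^bsub>W\<^esub>v\<in>A. T (a v \<odot>\<^bsub>V\<^esub> v))"
    unfolding V.module.lincomb_def using assms by (intro hom_sum) auto
  also have "\<dots> = (\<Oplus>\<^bsub>W\<^esub>v\<in>A. (a \<circ> the_inv_into A T) (T v) \<odot>\<^bsub>W\<^esub> T v)"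
    using assms by (intro W.module.M.finsum_cong2) (auto simp: the_inv_into_f_f Pi_def subset_iff)
  also have "\<dots> = W.module.lincomb (a \<circ> the_inv_into A T) (T ` A)"
    unfolding W.module.lincomb_def using assms
    by (intro W.module.M.finsum_reindex[symmetric]) (auto simp: the_inv_into_f_f Pi_def subset_iff)
  finally show ?thesis .
qed

lemma inj_on_if_ker_trivial:
  assumes F: "submodule K F V" and ker: "\<And>v. v \<in> F \<Longrightarrow> T v = \<zero>\<^bsub>W\<^esub> \<Longrightarrow> v = \<zero>\<^bsub>V\<^esub>"
  shows "inj_on T F"
proof (rule inj_onI)
  fix v w assume vw: "v \<in> F" "w \<in> F" "T v = T w"
  have c: "v \<in> carrier V" "w \<in> carrier V" using vw submodule.subset[OF F] by auto
  have "v \<ominus>\<^bsub>V\<^esub> w \<in> F" by (rule V.submodule_diff_closed[OF F vw(1,2)])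
  moreover have "T (v \<ominus>\<^bsub>V\<^esub> w) = \<zero>\<^bsub>W\<^esub>" using vw c by (simp add: W.module.M.r_neg a_minus_def)
  ultimately have "v \<ominus>\<^bsub>V\<^esub> w = \<zero>\<^bsub>V\<^esub>" by (rule ker)
  then show "v = w" using c by simp
qed

lemma lin_indpt_image:
  assumes S: "S \<subseteq> carrier V" "V.module.lin_indpt S"
    and ker: "\<And>v. v \<in> V.module.span S \<Longrightarrow> T v = \<zero>\<^bsub>W\<^esub> \<Longrightarrow> v = \<zero>\<^bsub>V\<^esub>"
  shows "inj_on T S" "W.module.lin_indpt (T ` S)"
proof -
  have inj: "inj_on T (V.module.span S)"
    using ker by (intro inj_on_if_ker_trivial V.module.span_is_submodule S) auto
  have Ssub: "S \<subseteq> V.module.span S" using V.module.in_own_span S by blast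
  then show injS: "inj_on T S" using inj inj_on_subset by blast
  have TS: "T ` S \<subseteq> carrier W" using S by auto
  show "W.module.lin_indpt (T ` S)"
    unfolding W.lin_indpt_iff_notin_span[OF TS]
  proof (intro ballI notI)
    fix w assume "w \<in> T ` S" and wsp: "w \<in> W.module.span (T ` S - {w})"
    then obtain s where s: "s \<in> S" "w = T s" by blast
    have "T ` S - {w} = T ` (S - {s})" using injS s by (auto simp: inj_on_def)
    then have "T s \<in> T ` V.module.span (S - {s})" using wsp s image_span[of "S - {s}"] S by auto
    moreover have "V.module.span (S - {s}) \<subseteq> V.module.span S" by (rule V.module.span_is_monotone) auto
    ultimately have "s \<in> V.module.span (S - {s})" using inj s Ssub by (auto simp: inj_on_def subset_iff)
    then show False using V.lin_indpt_iff_notin_span[OF S(1)] S s by blast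
  qed
qed

lemma lin_indpt_if_image:
  assumes S: "S \<subseteq> carrier V" and inj: "inj_on T S" and li: "W.module.lin_indpt (T ` S)"
  shows "V.module.lin_indpt S" and "\<And>v. v \<in> V.module.span S \<Longrightarrow> T v = \<zero>\<^bsub>W\<^esub> \<Longrightarrow> v = \<zero>\<^bsub>V\<^esub>"
proof -
  have TS: "T ` S \<subseteq> carrier W" using S by auto
  show "V.module.lin_indpt S"
    unfolding V.lin_indpt_iff_notin_span[OF S]
  proof (intro ballI notI)
    fix s assume s: "s \<in> S" "s \<in> V.module.span (S - {s})"
    have "T s \<in> W.module.span (T ` (S - {s}))" using image_span[of "S - {s}"] s S by blast
    moreover have "T ` (S - {s}) = T ` S - {T s}" using inj s by (auto simp: inj_on_def)
    ultimately show False using W.lin_indpt_iff_notin_span[OF TS] li s by auto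
  qed
  fix v assume v: "v \<in> V.module.span S" "T v = \<zero>\<^bsub>W\<^esub>"
  then obtain a A where A: "finite A" "A \<subseteq> S" "a \<in> A \<rightarrow> carrier K" "v = V.module.lincomb a A"
    unfolding V.module.span_def by blast
  have injA: "inj_on T A" using inj A inj_on_subset by blast
  let ?b = "a \<circ> the_inv_into A T"
  have "W.module.lincomb ?b (T ` A) = \<zero>\<^bsub>W\<^esub>" using lincomb_image[of A a] A S injA v by auto
  moreover have "?b \<in> T ` A \<rightarrow> carrier K" using A injA by (auto simp: the_inv_into_f_f Pi_def)
  ultimately have "?b \<in> T ` A \<rightarrow> {\<zero>\<^bsub>K\<^esub>}"
    using W.not_lindepD[OF li, of "T ` A" ?b] A by auto
  then have "a \<in> A \<rightarrow> {\<zero>\<^bsub>K\<^esub>}" using injA by (auto simp: the_inv_into_f_f Pi_def)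
  then show "v = \<zero>\<^bsub>V\<^esub>" using V.lincomb_zero[of A a] A S by auto
qed

end

section \<open>Flags and adapted bases\<close>

text \<open>
  The largest subspace comes first, so that structural induction on the list proceeds from smaller
  subspaces to larger ones, the direction in which bases are extended.
\<close>

definition flag :: "('k, 'm) ring_scheme \<Rightarrow> ('k, 'a, 'n) module_scheme \<Rightarrow> 'a set list \<Rightarrow> bool" where
  "flag K V Fs \<longleftrightarrow> (\<forall>F\<in>set Fs. submodule K F V) \<and> sorted_wrt (\<supseteq>) Fs"

definition adapted_basis ::
  "('k, 'm) ring_scheme \<Rightarrow> ('k, 'a, 'n) module_scheme \<Rightarrow> 'a set list \<Rightarrow> 'a set \<Rightarrow> bool" where
  "adapted_basis K V Fs B \<longleftrightarrow>
     vectorspace.basis K V B \<and> (\<forall>F\<in>set Fs. F \<subseteq> LinearCombinations.module.span K V (B \<inter> F))"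

text \<open>
  The condition on a pair of bases under which they split a linear map into maps between lines:
  the nonzero images of basis vectors are distinct basis vectors. The argument \<open>z\<close> is the zero of
  the target space.
\<close>

definition matching :: "('a \<Rightarrow> 'b) \<Rightarrow> 'b \<Rightarrow> 'a set \<Rightarrow> 'b set \<Rightarrow> bool" where
  "matching T z B C \<longleftrightarrow> (\<forall>b\<in>B. T b = z \<or> T b \<in> C) \<and> inj_on T {b \<in> B. T b \<noteq> z}"

text \<open>
  Induction from the smallest subspace upwards. Suppose that \<open>B\<close> is the set found for \<open>G\<close>, the
  largest member of \<open>Fs\<close>. The elements of \<open>C\<close> in \<open>F - G\<close> can be added to \<open>B\<close>: a combination of them
  that lies in \<open>G\<close> lies in \<open>W \<inter> G\<close>, hence is a combination of \<open>C \<inter> G\<close>, and so is zero because \<open>C\<close>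
  is independent. The result extends to a basis of \<open>F\<close>.
\<close>

lemma (in vectorspace) lin_indpt_extends_along_flag:
  assumes C: "lin_indpt C" "C \<subseteq> W" and W: "submodule K W V"
    and "flag K V (F # Fs)"
    and "\<And>G. G \<in> set (F # Fs) \<Longrightarrow> W \<inter> G \<subseteq> span (C \<inter> G)"
  shows "\<exists>B\<subseteq>F. C \<inter> F \<subseteq> B \<and> lin_indpt B \<and> (\<forall>G\<in>set (F # Fs). G \<subseteq> span (B \<inter> G))"
  using assms(4,5)
proof (induction Fs arbitrary: F)
  case Nil
  then have F: "F \<subseteq> carrier V" by (auto simp: flag_def dest: submodule.subset)
  have "lin_indpt (C \<inter> F)" using C subset_li_is_li by blast
  then obtain B where B: "C \<inter> F \<subseteq> B" "B \<subseteq> F" "lin_indpt B" "F \<subseteq> span B"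
    using lin_indpt_extends_within[of "C \<inter> F" F] F by blast
  then have "B \<inter> F = B" by blast
  with B show ?case by (intro exI[of _ B]) auto
next
  case (Cons G Fs)
  have "flag K V (G # Fs)" using Cons.prems(1) by (auto simp: flag_def)
  moreover have "W \<inter> H \<subseteq> span (C \<inter> H)" if "H \<in> set (G # Fs)" for H
    using Cons.prems(2)[of H] that by simp
  ultimately obtain B where B: "B \<subseteq> G" "C \<inter> G \<subseteq> B" "lin_indpt B"
    and gen: "\<forall>H\<in>set (G # Fs). H \<subseteq> span (B \<inter> H)"
    using Cons.IH[of G] by blast
  have F: "submodule K F V" and G: "submodule K G V" and sub: "\<And>H. H \<in> set (G # Fs) \<Longrightarrow> H \<subseteq> F"
    using Cons.prems(1) by (auto simp: flag_def)
  note FV = submodule.subset[OF F] and GV = submodule.subset[OF G] and WV = submodule.subset[OF W]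
  have CV: "C \<subseteq> carrier V" using C WV by blast
  have "span B \<inter> span (C \<inter> F - G) \<subseteq> G \<inter> W \<inter> span (C \<inter> F - G)"
    using span_is_subset[OF B(1) G] span_is_subset[of "C \<inter> F - G", OF _ W] C by blast
  also have "\<dots> \<subseteq> span (C \<inter> G) \<inter> span (C \<inter> F - G)"
    using Cons.prems(2)[of G] by auto
  also have "\<dots> \<subseteq> {\<zero>\<^bsub>V\<^esub>}" by (rule span_disjoint_Int[OF C(1) CV]) auto
  finally have "lin_indpt (B \<union> (C \<inter> F - G))"
    using B GV CV subset_li_is_li[OF C(1), of "C \<inter> F - G"] by (intro lin_indpt_Un) auto
  moreover have "B \<union> (C \<inter> F - G) \<subseteq> F" using B sub by auto
  ultimately obtain B' where B': "B \<union> (C \<inter> F - G) \<subseteq> B'" "B' \<subseteq> F" "lin_indpt B'" "F \<subseteq> span B'"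
    using lin_indpt_extends_within FV by blast
  have "H \<subseteq> span (B' \<inter> H)" if "H \<in> set (G # Fs)" for H
    using bspec[OF gen that] span_is_monotone[of "B \<inter> H" "B' \<inter> H"] B' by blast
  moreover have "B' \<inter> F = B'" using B' by blast
  moreover have "C \<inter> F \<subseteq> B'" using B B' by blast
  ultimately show ?case using B' by (intro exI[of _ B']) auto
qed

lemma (in vectorspace) lin_indpt_along_flag_exists:
  assumes "flag K V (F # Fs)"
  shows "\<exists>B\<subseteq>F. lin_indpt B \<and> (\<forall>G\<in>set (F # Fs). G \<subseteq> span (B \<inter> G))"
proof -
  have "submodule K {\<zero>\<^bsub>V\<^esub>} V"
    using span_is_submodule[of "{}"] by (simp add: span_empty)
  moreover have "lin_indpt {}" by (simp add: lin_dep_def)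
  ultimately have "\<exists>B\<subseteq>F. {} \<inter> F \<subseteq> B \<and> lin_indpt B \<and> (\<forall>G\<in>set (F # Fs). G \<subseteq> span (B \<inter> G))"
    using span_zero assms
    by (intro lin_indpt_extends_along_flag[of "{}" "{\<zero>\<^bsub>V\<^esub>}"]) blast+
  then show ?thesis by blast
qed

lemma (in vectorspace) carrier_submodule: "submodule K (carrier V) V"
  by unfold_locales auto

lemma (in vectorspace) flag_Cons_carrier:
  "flag K V Fs \<Longrightarrow> flag K V (carrier V # Fs)"
  using carrier_submodule by (auto simp: flag_def dest: submodule.subset)

lemma (in vectorspace) adapted_basisI:
  assumes "B \<subseteq> carrier V" "lin_indpt B" and gen: "\<forall>G\<in>set (carrier V # Fs). G \<subseteq> span (B \<inter> G)"
  shows "adapted_basis K V Fs B"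
proof -
  have "B \<inter> carrier V = B" using assms(1) by blast
  then have "basis B" using assms span_is_subset2[of B] by (simp add: basis_def)
  then show ?thesis using gen by (simp add: adapted_basis_def)
qed

lemma (in vectorspace) adapted_basis_exists:
  assumes "flag K V Fs"
  shows "\<exists>B. adapted_basis K V Fs B"
  using lin_indpt_along_flag_exists[OF flag_Cons_carrier[OF assms]] adapted_basisI by blast

lemma (in vectorspace) adapted_basis_extends:
  assumes C: "lin_indpt C" "C \<subseteq> W" and W: "submodule K W V"
    and Fs: "flag K V Fs"
    and gen: "W \<subseteq> span C" "\<And>F. F \<in> set Fs \<Longrightarrow> W \<inter> F \<subseteq> span (C \<inter> F)"
  obtains B where "C \<subseteq> B" "adapted_basis K V Fs B"
proof -
  note WV = submodule.subset[OF W]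
  have CV: "C \<inter> carrier V = C" "W \<inter> carrier V = W" using C WV by auto
  have "W \<inter> G \<subseteq> span (C \<inter> G)" if "G \<in> set (carrier V # Fs)" for G
    using that gen CV by (cases "G = carrier V") simp_all
  then obtain B where B: "B \<subseteq> carrier V" "C \<inter> carrier V \<subseteq> B" "lin_indpt B"
    and span: "\<forall>G\<in>set (carrier V # Fs). G \<subseteq> span (B \<inter> G)"
    using lin_indpt_extends_along_flag[OF C W flag_Cons_carrier[OF Fs]] by blast
  show ?thesis using that B(2) CV adapted_basisI[OF B(1,3) span] by simp
qed

text \<open>
  A lift chosen in the smallest subspace of the flag whose image contains \<open>b\<close> lies in all the
  larger ones as well.
\<close>

lemma flag_common_lift:
  assumes "sorted_wrt (\<supseteq>) (A # Fs)" "b \<in> T ` A"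
  shows "\<exists>v\<in>A. T v = b \<and> (\<forall>F\<in>set Fs. b \<in> T ` F \<longrightarrow> v \<in> F)"
  using assms
proof (induction Fs arbitrary: A)
  case (Cons F Fs)
  show ?case
  proof (cases "b \<in> T ` F")
    case True
    then obtain v where "v \<in> F" "T v = b" "\<forall>F\<in>set Fs. b \<in> T ` F \<longrightarrow> v \<in> F"
      using Cons.IH[of F] Cons.prems by auto
    then show ?thesis using Cons.prems by auto
  next
    case False
    have "b \<notin> T ` G" if "G \<in> set Fs" for G
    proof -
      have "G \<subseteq> F" using Cons.prems(1) that by simp
      then show ?thesis using False by blast
    qed
    then show ?thesis using False Cons.prems by auto
  qed
qed auto

section \<open>Carrying adapted bases across a linear map\<close>

context linear_map
begin

lemma flag_vimage:
  assumes "flag K W Gs"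
  shows "flag K V (map (\<lambda>G. {v \<in> carrier V. T v \<in> G}) Gs @ [ker])"
proof -
  have "submodule K ker V" by (rule ker_is_submodule)
  moreover have "ker \<subseteq> {v \<in> carrier V. T v \<in> G}" if "G \<in> set Gs" for G
  proof -
    have "\<zero>\<^bsub>W\<^esub> \<in> G" using assms that by (auto simp: flag_def dest: submodule.zero_closed)
    then show ?thesis by (auto simp: ker_def)
  qed
  moreover have "sorted_wrt (\<lambda>G H. {v \<in> carrier V. T v \<in> H} \<subseteq> {v \<in> carrier V. T v \<in> G}) Gs"
    by (rule sorted_wrt_mono_rel[of Gs "(\<supseteq>)"]) (use assms in \<open>auto simp: flag_def\<close>)
  ultimately show ?thesis
    using assms vimage_submodule unfolding flag_def by (auto simp: sorted_wrt_append sorted_wrt_map)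
qed

lemma flag_image:
  assumes "flag K V Fs"
  shows "flag K W (map ((`) T) (carrier V # Fs))"
proof -
  have "sorted_wrt (\<lambda>F G. T ` G \<subseteq> T ` F) Fs"
    by (rule sorted_wrt_mono_rel[of Fs "(\<supseteq>)"]) (use assms in \<open>auto simp: flag_def\<close>)
  moreover have "T ` F \<subseteq> T ` carrier V" if "F \<in> set Fs" for F
    using assms that submodule.subset[of K F V] by (intro image_mono) (simp add: flag_def)
  moreover have "submodule K (T ` F) W" if "F \<in> set (carrier V # Fs)" for F
    using that assms V.carrier_submodule by (intro image_submodule) (auto simp: flag_def)
  ultimately show ?thesis unfolding flag_def by (simp add: sorted_wrt_map)
qed

text \<open>
  Adaptedness to the kernel makes the images of the basis vectors outside the kernel independent,
  and adaptedness to the preimages makes these images a basis of \<open>imT\<close> adapted to the flag that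
  \<open>Gs\<close> induces there. Such a basis extends to an adapted basis of the whole target.
\<close>

lemma adapted_basis_along_backward:
  assumes Gs: "flag K W Gs"
    and B: "adapted_basis K V (map (\<lambda>G. {v \<in> carrier V. T v \<in> G}) Gs @ [ker]) B"
  shows "\<exists>C. adapted_basis K W Gs C \<and> matching T \<zero>\<^bsub>W\<^esub> B C"
proof -
  let ?B = "B - ker"
  have B': "V.module.lin_indpt B" "B \<subseteq> carrier V" "V.module.span B = carrier V" "ker \<subseteq> V.module.span (B \<inter> ker)"
    and gen: "\<And>G. G \<in> set Gs \<Longrightarrow> {v \<in> carrier V. T v \<in> G} \<subseteq> V.module.span (B \<inter> {v \<in> carrier V. T v \<in> G})"
    using B unfolding adapted_basis_def V.basis_def by simp_all
  have "V.module.lin_indpt ?B" using V.module.subset_li_is_li[OF B'(1)] by blast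
  moreover have "v = \<zero>\<^bsub>V\<^esub>" if "v \<in> V.module.span ?B" "T v = \<zero>\<^bsub>W\<^esub>" for v
  proof -
    have "?B \<subseteq> carrier V" using B' by blast
    then have "v \<in> carrier V" using that V.span_closed by blast
    then have "v \<in> V.module.span (B \<inter> ker) \<inter> V.module.span ?B" using that B' by (auto simp: ker_def)
    also have "\<dots> \<subseteq> {\<zero>\<^bsub>V\<^esub>}" by (rule V.span_disjoint_Int[OF B'(1,2)]) auto
    finally show ?thesis by simp
  qed
  ultimately have inj: "inj_on T ?B" and li: "W.module.lin_indpt (T ` ?B)"
    using lin_indpt_image[of ?B] B' by blast+
  \<comment> \<open>Basis vectors in the kernel only contribute the zero vector to the image.\<close>
  have image_gen: "T ` V.module.span S \<subseteq> W.module.span (T ` (S - ker))" if "S \<subseteq> B" for S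
  proof -
    have S: "S \<subseteq> carrier V" using that B' by blast
    have TS: "T ` (S - ker) \<subseteq> carrier W" using S by auto
    have "T ` S \<subseteq> W.module.span (T ` (S - ker))"
    proof
      fix w assume "w \<in> T ` S"
      then obtain v where v: "v \<in> S" "w = T v" by blast
      show "w \<in> W.module.span (T ` (S - ker))"
      proof (cases "v \<in> ker")
        case True
        then show ?thesis using v W.span_zero by (simp add: ker_def)
      next
        case False
        then show ?thesis using v W.module.in_own_span[OF TS] by blast
      qed
    qed
    then show ?thesis
      unfolding image_span[OF S] using W.module.span_is_submodule[OF TS] by (rule W.module.span_is_subset)
  qed
  have "imT \<subseteq> W.module.span (T ` ?B)" using image_gen[of B] B' by (simp add: im_def)
  moreover have "imT \<inter> G \<subseteq> W.module.span (T ` ?B \<inter> G)" if G: "G \<in> set Gs" for G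
  proof
    fix w assume "w \<in> imT \<inter> G"
    then obtain v where v: "v \<in> carrier V" "T v = w" "T v \<in> G" by (auto simp: im_def)
    then have "w \<in> T ` V.module.span (B \<inter> {v \<in> carrier V. T v \<in> G})" using gen[OF G] by blast
    also have "\<dots> \<subseteq> W.module.span (T ` (B \<inter> {v \<in> carrier V. T v \<in> G} - ker))"
      by (rule image_gen) auto
    also have "\<dots> \<subseteq> W.module.span (T ` ?B \<inter> G)" by (rule W.module.span_is_monotone) auto
    finally show "w \<in> W.module.span (T ` ?B \<inter> G)" .
  qed
  moreover have "T ` ?B \<subseteq> imT" using B' by (auto simp: im_def)
  ultimately obtain C where C: "T ` ?B \<subseteq> C" "adapted_basis K W Gs C"
    using W.adapted_basis_extends[OF li _ im_is_submodule Gs] by blast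
  have "matching T \<zero>\<^bsub>W\<^esub> B C"
    unfolding matching_def
  proof
    show "\<forall>b\<in>B. T b = \<zero>\<^bsub>W\<^esub> \<or> T b \<in> C" using C B' by (auto simp: ker_def)
    show "inj_on T {b \<in> B. T b \<noteq> \<zero>\<^bsub>W\<^esub>}"
      using inj by (rule inj_on_subset) (auto simp: ker_def)
  qed
  then show ?thesis using C by blast
qed

text \<open>
  Each vector of \<open>C\<close> in the image is lifted as deep into the flag \<open>Fs\<close> as possible. The lifts,
  together with an adapted basis of the kernel, form the required basis: for \<open>v \<in> F\<close>, the vector \<open>T v\<close>
  is a combination of vectors of \<open>C\<close> in \<open>T ` F\<close>, whose lifts lie in \<open>F\<close>, so that \<open>v\<close> differs from a
  combination of lifts in \<open>F\<close> by an element of \<open>F \<inter> ker\<close>.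
\<close>

lemma adapted_basis_along_forward:
  assumes Fs: "flag K V Fs"
    and C: "adapted_basis K W (map ((`) T) (carrier V # Fs)) C"
  shows "\<exists>B. adapted_basis K V Fs B \<and> matching T \<zero>\<^bsub>W\<^esub> B C"
proof -
  have C': "W.module.lin_indpt C" "C \<subseteq> carrier W"
    and gen: "\<And>F. F \<in> set (carrier V # Fs) \<Longrightarrow> T ` F \<subseteq> W.module.span (C \<inter> T ` F)"
    using C unfolding adapted_basis_def W.basis_def by fastforce+
  have flag: "flag K V (carrier V # Fs)" by (rule V.flag_Cons_carrier[OF Fs])
  have "\<forall>c\<in>C \<inter> T ` carrier V. \<exists>v\<in>carrier V. T v = c \<and> (\<forall>F\<in>set Fs. c \<in> T ` F \<longrightarrow> v \<in> F)"
    using flag_common_lift[of "carrier V" Fs _ T] flag by (auto simp: flag_def)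
  then obtain l where l: "\<And>c. c \<in> C \<inter> T ` carrier V \<Longrightarrow> l c \<in> carrier V \<and> T (l c) = c \<and> (\<forall>F\<in>set Fs. c \<in> T ` F \<longrightarrow> l c \<in> F)"
    by metis
  define Y where "Y = l ` (C \<inter> T ` carrier V)"
  have YV: "Y \<subseteq> carrier V" using l by (auto simp: Y_def)
  have TY: "T ` Y = C \<inter> T ` carrier V" using l by (force simp: Y_def image_image)
  have injY: "inj_on T Y" using l by (auto simp: Y_def inj_on_def)
  have "W.module.lin_indpt (T ` Y)" using TY W.module.subset_li_is_li[OF C'(1)] by blast
  note liY = lin_indpt_if_image[OF YV injY this]
  \<comment> \<open>\<open>X\<close> is a basis of the kernel adapted to the flag that \<open>Fs\<close> induces there.\<close>
  have "flag K V (ker # map (\<lambda>F. F \<inter> ker) Fs)"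
  proof -
    have "submodule K (F \<inter> ker) V" if "submodule K F V" for F
      using that ker_is_submodule unfolding submodule_def by auto
    moreover have "sorted_wrt (\<lambda>F G. G \<inter> ker \<subseteq> F \<inter> ker) Fs"
      by (rule sorted_wrt_mono_rel[of Fs "(\<supseteq>)"]) (use Fs in \<open>auto simp: flag_def\<close>)
    ultimately show ?thesis using Fs ker_is_submodule unfolding flag_def by (simp add: sorted_wrt_map)
  qed
  then have "\<exists>X\<subseteq>ker. V.module.lin_indpt X \<and>
      (\<forall>G\<in>set (ker # map (\<lambda>F. F \<inter> ker) Fs). G \<subseteq> V.module.span (X \<inter> G))"
    by (rule V.lin_indpt_along_flag_exists)
  then obtain X where X: "X \<subseteq> ker" "V.module.lin_indpt X"
    and genX: "\<forall>G\<in>set (ker # map (\<lambda>F. F \<inter> ker) Fs). G \<subseteq> V.module.span (X \<inter> G)"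
    by blast
  have XV: "X \<subseteq> carrier V" using X by (auto simp: ker_def)
  define B where "B = X \<union> Y"
  have "V.module.span X \<inter> V.module.span Y \<subseteq> {\<zero>\<^bsub>V\<^esub>}"
    using V.module.span_is_subset[OF X(1) ker_is_submodule] liY(2) by (auto simp: ker_def)
  then have liB: "V.module.lin_indpt B"
    unfolding B_def using X XV YV liY(1) by (intro V.lin_indpt_Un) auto
  have BV: "B \<subseteq> carrier V" using XV YV by (simp add: B_def)
  have genB: "F \<subseteq> V.module.span (B \<inter> F)" if F: "F \<in> set (carrier V # Fs)" for F
  proof
    fix v assume v: "v \<in> F"
    have Fsub: "submodule K F V" using F flag unfolding flag_def by blast
    note FV = submodule.subset[OF Fsub]
    have "C \<inter> T ` F \<subseteq> T ` (Y \<inter> F)"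
    proof
      fix c assume c: "c \<in> C \<inter> T ` F"
      then have "c \<in> C \<inter> T ` carrier V" using FV by auto
      moreover from this have "l c \<in> F" using l[of c] c F by auto
      ultimately show "c \<in> T ` (Y \<inter> F)" using l[of c] by (auto simp: Y_def intro!: image_eqI[of _ _ "l c"])
    qed
    then have "T v \<in> W.module.span (T ` (Y \<inter> F))"
      using gen[OF F] v W.module.span_is_monotone by blast
    then obtain y where y: "y \<in> V.module.span (Y \<inter> F)" "T v = T y"
      using image_span[of "Y \<inter> F"] FV by blast
    have yF: "y \<in> F" using y V.module.span_is_subset[of "Y \<inter> F", OF _ Fsub] by blast
    have vc: "v \<in> carrier V" "y \<in> carrier V" using v yF FV by auto
    have "v \<ominus>\<^bsub>V\<^esub> y \<in> F" by (rule V.submodule_diff_closed[OF Fsub v yF])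
    moreover have "T (v \<ominus>\<^bsub>V\<^esub> y) = \<zero>\<^bsub>W\<^esub>" using y vc by (simp add: W.module.M.r_neg a_minus_def)
    ultimately have "v \<ominus>\<^bsub>V\<^esub> y \<in> F \<inter> ker" using vc by (auto simp: ker_def)
    then have "v \<ominus>\<^bsub>V\<^esub> y \<in> V.module.span (X \<inter> F)"
    proof -
      have "F \<inter> ker \<in> set (ker # map (\<lambda>F. F \<inter> ker) Fs)"
        using F by (auto simp: ker_def)
      then have "F \<inter> ker \<subseteq> V.module.span (X \<inter> (F \<inter> ker))" by (rule bspec[OF genX])
      also have "\<dots> \<subseteq> V.module.span (X \<inter> F)" by (rule V.module.span_is_monotone) blast
      finally show ?thesis using \<open>v \<ominus>\<^bsub>V\<^esub> y \<in> F \<inter> ker\<close> by blast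
    qed
    then have *: "v \<ominus>\<^bsub>V\<^esub> y \<in> V.module.span (B \<inter> F)" "y \<in> V.module.span (B \<inter> F)"
      using y V.module.span_is_monotone[of "X \<inter> F" "B \<inter> F"] V.module.span_is_monotone[of "Y \<inter> F" "B \<inter> F"]
      by (auto simp: B_def)
    have "v = (v \<ominus>\<^bsub>V\<^esub> y) \<oplus>\<^bsub>V\<^esub> y" using vc by (simp add: a_minus_def V.module.M.a_assoc V.module.M.l_neg)
    then show "v \<in> V.module.span (B \<inter> F)" using * V.span_add1[of "B \<inter> F"] BV by (metis inf.coboundedI1)
  qed
  then have "adapted_basis K V Fs B" by (intro V.adapted_basisI[OF BV liB]) blast
  moreover have "matching T \<zero>\<^bsub>W\<^esub> B C"
    unfolding matching_def
  proof
    show "\<forall>b\<in>B. T b = \<zero>\<^bsub>W\<^esub> \<or> T b \<in> C" using X TY by (auto simp: B_def ker_def)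
    show "inj_on T {b \<in> B. T b \<noteq> \<zero>\<^bsub>W\<^esub>}"
      using injY by (rule inj_on_subset) (use X in \<open>auto simp: B_def ker_def\<close>)
  qed
  ultimately show ?thesis by blast
qed

end

section \<open>Matched bases along the path\<close>

definition bases_matched ::
  "('q0, 'q1) pre_digraph \<Rightarrow> ('q0, 'q1, 'k, 'a) quiver_rep \<Rightarrow> ('q0 \<Rightarrow> 'a set) \<Rightarrow> 'q1 \<Rightarrow> bool" where
  "bases_matched Q M \<B> \<alpha> \<longleftrightarrow>
     matching (vmap M \<alpha>) \<zero>\<^bsub>vspace M (head Q \<alpha>)\<^esub> (\<B> (tail Q \<alpha>)) (\<B> (head Q \<alpha>))"

text \<open>
  Both orientations of an arrow between \<open>x\<close> and \<open>y\<close> at once: the flag at \<open>y\<close> consists of images of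
  the one at \<open>x\<close> or of preimages of it.
\<close>

lemma flag_transport:
  assumes M: "is_rep K Q M" and \<alpha>: "\<alpha> \<in> arcs Q" "{tail Q \<alpha>, head Q \<alpha>} = {x, y}" "x \<noteq> y"
    and Fs: "flag K (vspace M x) Fs"
  shows "\<exists>Gs. flag K (vspace M y) Gs \<and>
    (\<forall>C. adapted_basis K (vspace M y) Gs C \<longrightarrow>
      (\<exists>B. adapted_basis K (vspace M x) Fs B \<and>
        (\<forall>\<B>. \<B> x = B \<longrightarrow> \<B> y = C \<longrightarrow> bases_matched Q M \<B> \<alpha>)))"
proof -
  interpret linear_map K "vspace M (tail Q \<alpha>)" "vspace M (head Q \<alpha>)" "vmap M \<alpha>"
    using M \<alpha> by (simp add: is_rep_def)
  consider "tail Q \<alpha> = x" "head Q \<alpha> = y" | "tail Q \<alpha> = y" "head Q \<alpha> = x"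
    using \<alpha>(2) by (auto simp: doubleton_eq_iff)
  then show ?thesis
  proof cases
    case 1
    have F: "flag K (vspace M (tail Q \<alpha>)) Fs" using Fs 1(1) by simp
    have "\<exists>B. adapted_basis K (vspace M x) Fs B \<and>
        (\<forall>\<B>. \<B> x = B \<longrightarrow> \<B> y = C \<longrightarrow> bases_matched Q M \<B> \<alpha>)"
      if "adapted_basis K (vspace M (head Q \<alpha>)) (map ((`) (vmap M \<alpha>)) (carrier (vspace M (tail Q \<alpha>)) # Fs)) C" for C
      using adapted_basis_along_forward[OF F that] 1 by (auto simp: bases_matched_def)
    then show ?thesis using flag_image[OF F] 1(2) by blast
  next
    case 2
    have F: "flag K (vspace M (head Q \<alpha>)) Fs" using Fs 2(2) by simp
    have "\<exists>B. adapted_basis K (vspace M x) Fs B \<and>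
        (\<forall>\<B>. \<B> x = B \<longrightarrow> \<B> y = C \<longrightarrow> bases_matched Q M \<B> \<alpha>)"
      if "adapted_basis K (vspace M (tail Q \<alpha>))
        (map (\<lambda>G. {v \<in> carrier (vspace M (tail Q \<alpha>)). vmap M \<alpha> v \<in> G}) Fs @ [ker]) C" for C
      using adapted_basis_along_backward[OF F that] 2 by (auto simp: bases_matched_def)
    then show ?thesis using flag_vimage[OF F] 2(1) by blast
  qed
qed

text \<open>
  Only a basis adapted to a suitable flag can be prolonged to the left, and a step to the right
  may force all earlier bases to be replaced. The induction along the path therefore provides a
  flag at the last vertex such that every basis adapted to this flag is the last member of a
  matched family.
\<close>

lemma matched_bases_exist:
  assumes M: "is_rep K Q M" and Q: "type_A n Q" and n: "n \<ge> 1"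
  obtains \<B> where "\<And>x. x \<in> verts Q \<Longrightarrow> vectorspace.basis K (vspace M x) (\<B> x)"
    and "\<And>\<alpha>. \<alpha> \<in> arcs Q \<Longrightarrow> bases_matched Q M \<B> \<alpha>"
proof -
  obtain p e where p: "bij_betw p {1..n} (verts Q)" and e: "bij_betw e {1..<n} (arcs Q)"
    and ends: "\<And>i. i \<in> {1..<n} \<Longrightarrow> {tail Q (e i), head Q (e i)} = {p i, p (i + 1)}"
    using Q unfolding type_A_def by blast
  have verts: "p i \<in> verts Q" if "i \<in> {1..n}" for i using p that by (auto simp: bij_betw_def)
  have inj: "p i \<noteq> p j" if "i \<in> {1..n}" "j \<in> {1..n}" "i \<noteq> j" for i j
    using inj_onD[OF bij_betw_imp_inj_on[OF p]] that by blast
  define P where "P m \<B> \<longleftrightarrow> (\<forall>j\<in>{1..m}. vectorspace.basis K (vspace M (p j)) (\<B> (p j))) \<and>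
      (\<forall>j\<in>{1..<m}. bases_matched Q M \<B> (e j))" for m \<B>
  have vs: "vectorspace K (vspace M (p i))" if "i \<in> {1..n}" for i
    using M verts[OF that] by (simp add: is_rep_def)
  have "\<exists>Fs. flag K (vspace M (p m)) Fs \<and>
      (\<forall>B. adapted_basis K (vspace M (p m)) Fs B \<longrightarrow> (\<exists>\<B>. \<B> (p m) = B \<and> P m \<B>))"
    if "1 \<le> m" "m \<le> n" for m
    using that
  proof (induction m rule: dec_induct)
    case base
    show ?case
    proof (intro exI[of _ "[]"] conjI allI impI)
      show "flag K (vspace M (p 1)) []" by (simp add: flag_def)
      fix B assume "adapted_basis K (vspace M (p 1)) [] B"
      then show "\<exists>\<B>. \<B> (p 1) = B \<and> P 1 \<B>"
        by (intro exI[of _ "\<lambda>_. B"]) (simp add: P_def adapted_basis_def)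
    qed
  next
    case (step m)
    then obtain Fs where Fs: "flag K (vspace M (p m)) Fs"
      and ext: "\<forall>B. adapted_basis K (vspace M (p m)) Fs B \<longrightarrow> (\<exists>\<B>. \<B> (p m) = B \<and> P m \<B>)"
      using Suc_leD by blast
    have m: "m \<in> {1..<n}" using step by auto
    have "e m \<in> arcs Q" using e m by (auto simp: bij_betw_def)
    moreover have "p m \<noteq> p (m + 1)" using m by (intro inj) auto
    ultimately obtain Gs where Gs: "flag K (vspace M (p (m + 1))) Gs"
      and tr: "\<forall>C. adapted_basis K (vspace M (p (m + 1))) Gs C \<longrightarrow>
        (\<exists>B. adapted_basis K (vspace M (p m)) Fs B \<and>
          (\<forall>\<B>. \<B> (p m) = B \<longrightarrow> \<B> (p (m + 1)) = C \<longrightarrow> bases_matched Q M \<B> (e m)))"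
      using flag_transport[OF M _ ends[OF m] _ Fs] by blast
    have "\<exists>\<B>. \<B> (p (Suc m)) = C \<and> P (Suc m) \<B>"
      if C: "adapted_basis K (vspace M (p (Suc m))) Gs C" for C
    proof -
      obtain B where B: "adapted_basis K (vspace M (p m)) Fs B"
        and match: "\<forall>\<B>. \<B> (p m) = B \<longrightarrow> \<B> (p (Suc m)) = C \<longrightarrow> bases_matched Q M \<B> (e m)"
        using spec[OF tr, of C] C by (elim impE exE conjE) simp_all
      obtain \<B> where \<B>: "\<B> (p m) = B" "P m \<B>" using ext B by blast
      define \<B>' where "\<B>' = \<B>(p (Suc m) := C)"
      have old: "\<B>' (p j) = \<B> (p j)" if "j \<in> {1..m}" for j
        using inj[of j "Suc m"] that m by (auto simp: \<B>'_def)
      have new: "\<B>' (p (Suc m)) = C" by (simp add: \<B>'_def)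
      have "bases_matched Q M \<B>' (e j)" if "j \<in> {1..<m}" for j
      proof -
        have "tail Q (e j) \<in> {p j, p (j + 1)}" "head Q (e j) \<in> {p j, p (j + 1)}"
          using ends[of j] that m by auto
        then have "\<B>' (tail Q (e j)) = \<B> (tail Q (e j))" "\<B>' (head Q (e j)) = \<B> (head Q (e j))"
          using old[of j] old[of "j + 1"] that by auto
        then show ?thesis using \<B>(2) that by (simp add: P_def bases_matched_def)
      qed
      moreover have "bases_matched Q M \<B>' (e m)"
        using spec[OF match, of \<B>'] old[of m] \<B>(1) new m by simp
      ultimately have edges: "bases_matched Q M \<B>' (e j)" if "j \<in> {1..<Suc m}" for j
        using that by (cases "j = m") auto
      have "vectorspace.basis K (vspace M (p j)) (\<B>' (p j))" if "j \<in> {1..Suc m}" for j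
        using that C \<B>(2) old[of j] new by (cases "j = Suc m") (auto simp: P_def adapted_basis_def)
      then have "P (Suc m) \<B>'" using edges by (simp add: P_def)
      then show ?thesis using new by blast
    qed
    then show ?case using Gs by (intro exI[of _ Gs]) simp
  qed
  from this[of n] n obtain Fs where Fs: "flag K (vspace M (p n)) Fs"
    and ext: "\<forall>B. adapted_basis K (vspace M (p n)) Fs B \<longrightarrow> (\<exists>\<B>. \<B> (p n) = B \<and> P n \<B>)"
    by blast
  obtain B where "adapted_basis K (vspace M (p n)) Fs B"
    using vectorspace.adapted_basis_exists[OF vs Fs] n by auto
  then obtain \<B> where \<B>: "P n \<B>" using ext by blast
  show ?thesis
  proof
    fix x assume "x \<in> verts Q"
    then obtain j where "j \<in> {1..n}" "x = p j" using p unfolding bij_betw_def by blast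
    then show "vectorspace.basis K (vspace M x) (\<B> x)" using \<B> by (simp add: P_def)
  next
    fix \<alpha> assume "\<alpha> \<in> arcs Q"
    then obtain j where "j \<in> {1..<n}" "\<alpha> = e j" using e unfolding bij_betw_def by blast
    then show "bases_matched Q M \<B> \<alpha>" using \<B> by (simp add: P_def)
  qed
qed

section \<open>Labelling basis vectors by their intervals\<close>

text \<open>
  \<open>R j b c\<close> says that \<open>b\<close> at position \<open>j\<close> and \<open>c\<close> at position \<open>j + 1\<close> are linked. When every vector has
  at most one partner on each side, the linked vectors form strings. The origin of a vector is the
  leftmost vector of its string, together with the position of that vector.
\<close>

primrec origin :: "(nat \<Rightarrow> 'a \<Rightarrow> 'a \<Rightarrow> bool) \<Rightarrow> nat \<Rightarrow> 'a \<Rightarrow> nat \<times> 'a" where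
  "origin R 0 c = (0, c)"
| "origin R (Suc j) c = (if \<exists>b. R j b c then origin R j (THE b. R j b c) else (Suc j, c))"

lemma origin_le: "fst (origin R j c) \<le> j"
  by (induction j arbitrary: c) (auto simp: le_SucI)

text \<open>
  The vertices of the path are numbered from 1, so that position 0 carries no links.
\<close>

lemma origin_pos:
  assumes "\<And>b c. \<not> R 0 b c"
  shows "1 \<le> j \<Longrightarrow> 1 \<le> fst (origin R j c)"
proof (induction j arbitrary: c)
  case (Suc j)
  then show ?case using assms by (cases j) auto
qed simp

lemma origin_link:
  assumes "\<exists>\<^sub>\<le>\<^sub>1b. R j b c" and "R j b c"
  shows "origin R (Suc j) c = origin R j b"
  using the1_equality'[OF assms] assms(2) by auto

lemma inj_origin:
  assumes left: "\<And>j c. \<exists>\<^sub>\<le>\<^sub>1b. R j b c" and right: "\<And>j b. \<exists>\<^sub>\<le>\<^sub>1c. R j b c"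
  shows "origin R j c = origin R j c' \<Longrightarrow> c = c'"
proof (induction j arbitrary: c c')
  case (Suc j)
  show ?case
  proof (cases "\<exists>b. R j b c"; cases "\<exists>b. R j b c'")
    assume "\<exists>b. R j b c" "\<exists>b. R j b c'"
    then obtain b b' where b: "R j b c" "R j b' c'" by blast
    then have "origin R j b = origin R j b'"
      using Suc.prems by (simp only: origin_link[of R j c b, OF left b(1)] origin_link[of R j c' b', OF left b(2)])
    then have "b' = b" using Suc.IH by blast
    then show ?thesis using b Uniq_D[OF right] by metis
  next
    assume "\<exists>b. R j b c" "\<nexists>b. R j b c'"
    then show ?thesis using Suc.prems origin_le[of R j "THE b. R j b c"] by auto
  next
    assume "\<nexists>b. R j b c" "\<exists>b. R j b c'"
    then show ?thesis using Suc.prems[symmetric] origin_le[of R j "THE b. R j b c'"] by auto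
  qed (use Suc.prems in auto)
qed simp

text \<open>
  A quantity that is constant along links keeps its value on the way from a vector back to its
  origin. Taken with truth values, this says that strings are connected.
\<close>

lemma origin_invariant:
  assumes left: "\<And>j c. \<exists>\<^sub>\<le>\<^sub>1b. R j b c"
    and P: "\<And>j b c. R j b c \<Longrightarrow> P j b = P (Suc j) c"
  shows "P j c = case_prod P (origin R j c)"
proof (induction j arbitrary: c)
  case (Suc j)
  show ?case
  proof (cases "\<exists>b. R j b c")
    case True
    then obtain b where b: "R j b c" by blast
    then show ?thesis using Suc.IH[of b] P[OF b] origin_link[of R j c b, OF left b] by simp
  qed simp
qed simp

text \<open>
  What the decomposition needs to know about the strings of matched basis vectors: the label of a
  vector names its string. Connectedness of the strings is expressed through properties that are
  constant along the nonzero images of basis vectors.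
\<close>

locale labelled_bases =
  fixes K :: "('k, 'm) ring_scheme" and Q :: "('q0, 'q1) pre_digraph"
    and M :: "('q0, 'q1, 'k, 'a) quiver_rep"
    and \<B> :: "'q0 \<Rightarrow> 'a set" and lab :: "'q0 \<Rightarrow> 'a \<Rightarrow> 'i"
  assumes fieldK: "field K" and wf: "wf_digraph Q" and rep: "is_rep K Q M"
    and basis: "\<And>x. x \<in> verts Q \<Longrightarrow> vectorspace.basis K (vspace M x) (\<B> x)"
    and matched: "\<And>\<alpha>. \<alpha> \<in> arcs Q \<Longrightarrow> bases_matched Q M \<B> \<alpha>"
    and lab_inj: "\<And>x. x \<in> verts Q \<Longrightarrow> inj_on (lab x) (\<B> x)"
    and lab_arrow: "\<And>\<alpha> b. \<alpha> \<in> arcs Q \<Longrightarrow> b \<in> \<B> (tail Q \<alpha>) \<Longrightarrow>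
      vmap M \<alpha> b \<noteq> \<zero>\<^bsub>vspace M (head Q \<alpha>)\<^esub> \<Longrightarrow> lab (head Q \<alpha>) (vmap M \<alpha> b) = lab (tail Q \<alpha>) b"
    and lab_connected: "\<And>P x y b c.
      (\<And>\<alpha> b. \<alpha> \<in> arcs Q \<Longrightarrow> b \<in> \<B> (tail Q \<alpha>) \<Longrightarrow> vmap M \<alpha> b \<noteq> \<zero>\<^bsub>vspace M (head Q \<alpha>)\<^esub> \<Longrightarrow>
         P (tail Q \<alpha>) b = P (head Q \<alpha>) (vmap M \<alpha> b)) \<Longrightarrow>
      x \<in> verts Q \<Longrightarrow> y \<in> verts Q \<Longrightarrow> b \<in> \<B> x \<Longrightarrow> c \<in> \<B> y \<Longrightarrow> lab x b = lab y c \<Longrightarrow>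
      P x b \<longleftrightarrow> (P y c :: bool)"

lemma type_A_labelled_bases:
  fixes M :: "('q0, 'q1, 'k, 'a) quiver_rep"
  assumes K: "field K" and Q: "type_A n Q" and n: "n \<ge> 1" and M: "is_rep K Q M"
  obtains \<B> and lab :: "'q0 \<Rightarrow> 'a \<Rightarrow> 'q0 \<times> 'a" where "labelled_bases K Q M \<B> lab"
proof -
  obtain \<B> where basis: "\<And>x. x \<in> verts Q \<Longrightarrow> vectorspace.basis K (vspace M x) (\<B> x)"
    and matched: "\<And>\<alpha>. \<alpha> \<in> arcs Q \<Longrightarrow> bases_matched Q M \<B> \<alpha>"
    using matched_bases_exist[OF M Q n] by blast
  obtain p e where fin: "fin_digraph Q" and p: "bij_betw p {1..n} (verts Q)" and e: "bij_betw e {1..<n} (arcs Q)"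
    and ends: "\<And>i. i \<in> {1..<n} \<Longrightarrow> {tail Q (e i), head Q (e i)} = {p i, p (i + 1)}"
    using Q unfolding type_A_def by blast
  interpret fin_digraph Q by fact
  have injp: "inj_on p {1..n}" using p by (rule bij_betw_imp_inj_on)
  \<comment> \<open>\<open>A\<close> follows the direction of the arrow, \<open>R\<close> always goes from \<open>p j\<close> to \<open>p (j + 1)\<close>.\<close>
  define A where "A j b c \<longleftrightarrow> b \<in> \<B> (tail Q (e j)) \<and> c \<in> \<B> (head Q (e j)) \<and> vmap M (e j) b = c" for j b c
  define R where "R j b c \<longleftrightarrow> j \<in> {1..<n} \<and> (if tail Q (e j) = p j then A j b c else A j c b)" for j b c
  have nz: "b \<noteq> \<zero>\<^bsub>vspace M x\<^esub>" if "b \<in> \<B> x" "x \<in> verts Q" for b x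
  proof -
    interpret vectorspace K "vspace M x" using M that by (simp add: is_rep_def)
    show ?thesis using basis[OF that(2)] that(1) vs_zero_lin_dep[of "\<B> x"] by (auto simp: basis_def)
  qed
  have earc: "e j \<in> arcs Q" if "j \<in> {1..<n}" for j using e that by (auto simp: bij_betw_def)
  have A_left: "b = b'" if "A j b c" "A j b' c" "j \<in> {1..<n}" for j b b' c
    using that matched[OF earc[OF that(3)]] nz[of c "head Q (e j)"] earc[OF that(3)]
    by (auto simp: A_def bases_matched_def matching_def inj_on_def)
  have A_right: "c = c'" if "A j b c" "A j b c'" for j b c c'
    using that by (auto simp: A_def)
  have left: "\<exists>\<^sub>\<le>\<^sub>1b. R j b c" for j c
    using A_left A_right by (intro Uniq_I) (auto simp: R_def split: if_splits)
  have right: "\<exists>\<^sub>\<le>\<^sub>1c. R j b c" for j b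
    using A_left A_right by (intro Uniq_I) (auto simp: R_def split: if_splits)
  have R0: "\<not> R 0 b c" for b c by (simp add: R_def)
  define idx where "idx = the_inv_into {1..n} p"
  have idx: "idx (p j) = j" if "j \<in> {1..n}" for j
    unfolding idx_def using injp that by (rule the_inv_into_f_f)
  have idx_in: "idx x \<in> {1..n}" "p (idx x) = x" if x: "x \<in> verts Q" for x
  proof -
    have "x \<in> p ` {1..n}" using p x by (simp add: bij_betw_def)
    then obtain j where j: "x = p j" "j \<in> {1..n}" by (rule imageE)
    show "idx x \<in> {1..n}" "p (idx x) = x"
      unfolding j(1) idx[OF j(2)] by (rule j(2), rule refl)
  qed
  define lab where "lab x b = map_prod p id (origin R (idx x) b)" for x b
  have origin_in: "fst (origin R j b) \<in> {1..n}" if "j \<in> {1..n}" for j b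
    using origin_pos[of R j b, OF R0] origin_le[of R j b] that by auto
  have lab_eq: "origin R (idx x) b = origin R (idx y) c"
    if "lab x b = lab y c" "x \<in> verts Q" "y \<in> verts Q" for x y b c
  proof -
    have "p (fst (origin R (idx x) b)) = p (fst (origin R (idx y) c))"
      using arg_cong[OF that(1), of fst] by (simp only: lab_def fst_map_prod)
    then have "fst (origin R (idx x) b) = fst (origin R (idx y) c)"
      by (rule inj_onD[OF injp]) (intro origin_in idx_in that)+
    moreover have "snd (origin R (idx x) b) = snd (origin R (idx y) c)"
      using arg_cong[OF that(1), of snd] by (simp only: lab_def snd_map_prod id_apply)
    ultimately show ?thesis by (rule prod_eqI)
  qed
  have arrow: "\<exists>j\<in>{1..<n}. \<alpha> = e j \<and>
      (tail Q \<alpha> = p j \<and> head Q \<alpha> = p (Suc j) \<and> R j b (vmap M \<alpha> b) \<or>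
       tail Q \<alpha> = p (Suc j) \<and> head Q \<alpha> = p j \<and> R j (vmap M \<alpha> b) b)"
    if \<alpha>: "\<alpha> \<in> arcs Q" and b: "b \<in> \<B> (tail Q \<alpha>)" "vmap M \<alpha> b \<noteq> \<zero>\<^bsub>vspace M (head Q \<alpha>)\<^esub>" for \<alpha> b
  proof -
    have "\<alpha> \<in> e ` {1..<n}" using \<alpha> e by (simp add: bij_betw_def)
    then obtain j where j: "\<alpha> = e j" "j \<in> {1..<n}" by (rule imageE)
    have "A j b (vmap M \<alpha> b)"
      using b matched[OF \<alpha>] j(1) by (auto simp: A_def bases_matched_def matching_def)
    moreover have "p j \<noteq> p (Suc j)" using inj_onD[OF injp, of j "Suc j"] j(2) by auto
    ultimately show ?thesis
      using ends[OF j(2)] j by (intro bexI[OF _ j(2)]) (auto simp: R_def doubleton_eq_iff)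
  qed
  have "labelled_bases K Q M \<B> lab"
  proof (rule labelled_bases.intro[OF K _ M basis matched])
    show "wf_digraph Q" by unfold_locales
  next
    fix x assume x: "x \<in> verts Q"
    show "inj_on (lab x) (\<B> x)"
      using lab_eq[OF _ x x] inj_origin[of R, OF left right] by (blast intro: inj_onI)
  next
    fix \<alpha> b assume \<alpha>: "\<alpha> \<in> arcs Q" "b \<in> \<B> (tail Q \<alpha>)" "vmap M \<alpha> b \<noteq> \<zero>\<^bsub>vspace M (head Q \<alpha>)\<^esub>"
    then obtain j where j: "j \<in> {1..<n}"
      "tail Q \<alpha> = p j \<and> head Q \<alpha> = p (Suc j) \<and> R j b (vmap M \<alpha> b) \<or>
       tail Q \<alpha> = p (Suc j) \<and> head Q \<alpha> = p j \<and> R j (vmap M \<alpha> b) b"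
      using arrow by blast
    have "idx (p j) = j" "idx (p (Suc j)) = Suc j" using j(1) by (auto intro!: idx)
    then have "origin R (idx (head Q \<alpha>)) (vmap M \<alpha> b) = origin R (idx (tail Q \<alpha>)) b"
      using j(2) origin_link[of R j, OF left] by metis
    then show "lab (head Q \<alpha>) (vmap M \<alpha> b) = lab (tail Q \<alpha>) b" by (simp only: lab_def)
  next
    fix P :: "'q0 \<Rightarrow> 'a \<Rightarrow> bool" and x y b c
    assume inv: "\<And>\<alpha> b. \<alpha> \<in> arcs Q \<Longrightarrow> b \<in> \<B> (tail Q \<alpha>) \<Longrightarrow> vmap M \<alpha> b \<noteq> \<zero>\<^bsub>vspace M (head Q \<alpha>)\<^esub> \<Longrightarrow>
         P (tail Q \<alpha>) b = P (head Q \<alpha>) (vmap M \<alpha> b)"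
      and xy: "x \<in> verts Q" "y \<in> verts Q" and eq: "lab x b = lab y c"
    have "P (p j) b = P (p (Suc j)) c" if R: "R j b c" for j b c
    proof -
      have j: "j \<in> {1..<n}" using R by (simp add: R_def)
      show ?thesis
      proof (cases "tail Q (e j) = p j")
        case True
        then have "head Q (e j) = p (Suc j)" using ends[OF j] by (auto simp: doubleton_eq_iff)
        then show ?thesis
          using R True inv[OF earc[OF j], of b] nz[of c, OF _ head_in_verts[OF earc[OF j]]] by (auto simp: R_def A_def)
      next
        case False
        then have "tail Q (e j) = p (Suc j)" "head Q (e j) = p j"
          using ends[OF j] by (auto simp: doubleton_eq_iff)
        then show ?thesis
          using R False inv[OF earc[OF j], of c] nz[of b, OF _ head_in_verts[OF earc[OF j]]] by (auto simp: R_def A_def)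
      qed
    qed
    note inv' = origin_invariant[of R "\<lambda>j. P (p j)", OF left this]
    have "P (p (idx x)) b = P (p (idx y)) c"
      by (rule trans[OF inv'[of "idx x" b, unfolded lab_eq[OF eq xy]] inv'[of "idx y" c, symmetric]])
    then show "P x b \<longleftrightarrow> P y c" by (simp only: idx_in(2)[OF xy(1)] idx_in(2)[OF xy(2)])
  qed
  then show ?thesis by (rule that)
qed

section \<open>Direct sums\<close>

lemma linear_map_inverse:
  assumes T: "linear_map K V W T" and bij: "bij_betw T (carrier V) (carrier W)"
  shows "linear_map K W V (the_inv_into (carrier V) T)"
proof -
  interpret linear_map K V W T by fact
  let ?S = "the_inv_into (carrier V) T"
  note inj = bij_betw_imp_inj_on[OF bij]
  have S: "?S w \<in> carrier V" "T (?S w) = w" if "w \<in> carrier W" for w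
    using the_inv_into_into[OF inj _ subset_refl] f_the_inv_into_f[OF inj] that
      bij_betw_imp_surj_on[OF bij] by auto
  have eqI: "?S w = v" if "v \<in> carrier V" "T v = w" for v w
    using the_inv_into_f_f[OF inj that(1)] that(2) by simp
  show ?thesis
  proof (intro linear_map.intro mod_hom.intro mod_hom_axioms.intro)
    show "?S \<in> LinearCombinations.module_hom K W V"
      unfolding LinearCombinations.module_hom_def using S by (auto intro!: eqI)
  qed unfold_locales
qed

lemma (in vectorspace) submodule_vectorspace:
  assumes "submodule K F V"
  shows "vectorspace K (V\<lparr>carrier := F\<rparr>)"
  by (rule subspace_is_vs[OF VectorSpace.subspace.intro[OF vectorspace_axioms assms]])

lemma linear_map_restrict:
  assumes T: "linear_map K V W T" and F: "submodule K F V" and G: "submodule K G W" and FG: "T ` F \<subseteq> G"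
  shows "linear_map K (V\<lparr>carrier := F\<rparr>) (W\<lparr>carrier := G\<rparr>) T"
proof -
  interpret linear_map K V W T by fact
  have V': "vectorspace K (V\<lparr>carrier := F\<rparr>)" and W': "vectorspace K (W\<lparr>carrier := G\<rparr>)"
    by (rule V.submodule_vectorspace[OF F], rule W.submodule_vectorspace[OF G])
  have "T \<in> LinearCombinations.module_hom K (V\<lparr>carrier := F\<rparr>) (W\<lparr>carrier := G\<rparr>)"
    using submodule.subset[OF F] FG by (auto simp: LinearCombinations.module_hom_def subset_iff)
  then show ?thesis
    using V' W' by (intro linear_map.intro mod_hom.intro mod_hom_axioms.intro vectorspace.axioms)
qed

lemma (in vectorspace) span_singleton:
  assumes "b \<in> carrier V"
  shows "span {b} = {c \<odot>\<^bsub>V\<^esub> b |c. c \<in> carrier K}"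
proof -
  have "lincomb a {b} = a b \<odot>\<^bsub>V\<^esub> b" if "a b \<in> carrier K" for a
    using assms that by (simp add: lincomb_def)
  then have "span {b} = {a b \<odot>\<^bsub>V\<^esub> b |a. a b \<in> carrier K}"
    using finite_span[of "{b}"] assms by (auto simp: Pi_def) metis+
  also have "\<dots> = {c \<odot>\<^bsub>V\<^esub> b |c. c \<in> carrier K}"
    by (auto intro: exI[of _ "\<lambda>_. _"])
  finally show ?thesis .
qed

lemma (in vectorspace) smult_eq_zero:
  assumes "c \<in> carrier K" "v \<in> carrier V" "c \<odot>\<^bsub>V\<^esub> v = \<zero>\<^bsub>V\<^esub>" "v \<noteq> \<zero>\<^bsub>V\<^esub>"
  shows "c = \<zero>\<^bsub>K\<^esub>"
proof (rule ccontr)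
  assume c: "c \<noteq> \<zero>\<^bsub>K\<^esub>"
  have "v = inv\<^bsub>K\<^esub> c \<odot>\<^bsub>V\<^esub> \<zero>\<^bsub>V\<^esub>" by (rule mult_inverse[OF assms(1,2,3) c])
  also have "\<dots> = \<zero>\<^bsub>V\<^esub>" using c assms(1) by (simp add: field_Units)
  finally show False using assms(4) by simp
qed

lemma module_dsum_simps [simp]:
  "carrier (module_dsum I G) = {f \<in> (\<Pi>\<^sub>E i\<in>I. carrier (G i)). finite {i \<in> I. f i \<noteq> \<zero>\<^bsub>G i\<^esub>}}"
  "\<zero>\<^bsub>module_dsum I G\<^esub> = (\<lambda>i\<in>I. \<zero>\<^bsub>G i\<^esub>)"
  "f \<oplus>\<^bsub>module_dsum I G\<^esub> g = (\<lambda>i\<in>I. f i \<oplus>\<^bsub>G i\<^esub> g i)"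
  "c \<odot>\<^bsub>module_dsum I G\<^esub> f = (\<lambda>i\<in>I. c \<odot>\<^bsub>G i\<^esub> f i)"
  by (simp_all add: module_dsum_def)

text \<open>
  The canonical map from the direct sum of subspaces of \<open>V\<close> to \<open>V\<close>. Restricting to the support
  matters, since \<^const>\<open>finsum\<close> over an infinite set is zero by convention.
\<close>

definition dsum_sum :: "'i set \<Rightarrow> ('k, 'a) module \<Rightarrow> ('i \<Rightarrow> 'a) \<Rightarrow> 'a" where
  "dsum_sum I V f = finsum V f {i \<in> I. f i \<noteq> \<zero>\<^bsub>V\<^esub>}"

lemma (in vectorspace) finsum_supported:
  assumes "finite J" "J \<subseteq> I" "{i \<in> I. f i \<noteq> \<zero>\<^bsub>V\<^esub>} \<subseteq> J" "f \<in> I \<rightarrow> carrier V"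
  shows "finsum V f {i \<in> I. f i \<noteq> \<zero>\<^bsub>V\<^esub>} = finsum V f J"
  using assms by (intro M.add.finprod_mono_neutral_cong_left) (auto simp: Pi_def subset_iff)

lemma dsum_sum_linear:
  assumes V: "vectorspace K V" and F: "\<And>i. i \<in> I \<Longrightarrow> submodule K (F i) V"
  shows "linear_map K (module_dsum I (\<lambda>i. V\<lparr>carrier := F i\<rparr>)) V (dsum_sum I V)"
proof -
  interpret V: vectorspace K V by fact
  let ?D = "module_dsum I (\<lambda>i. V\<lparr>carrier := F i\<rparr>)"
  have D: "vectorspace K ?D"
    using F by (intro vectorspace_module_dsum V.field_axioms V.submodule_vectorspace)
  have FV: "f \<in> I \<rightarrow> carrier V" if "f \<in> carrier ?D" for f
    using that submodule.subset[OF F] by (auto simp: PiE_iff)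
  have fin: "finite {i \<in> I. f i \<noteq> \<zero>\<^bsub>V\<^esub>}" if "f \<in> carrier ?D" for f
    using that by simp
  have add: "dsum_sum I V (f \<oplus>\<^bsub>?D\<^esub> g) = dsum_sum I V f \<oplus>\<^bsub>V\<^esub> dsum_sum I V g"
    if f: "f \<in> carrier ?D" and g: "g \<in> carrier ?D" for f g
  proof -
    let ?J = "{i \<in> I. f i \<noteq> \<zero>\<^bsub>V\<^esub>} \<union> {i \<in> I. g i \<noteq> \<zero>\<^bsub>V\<^esub>}"
    have J: "finite ?J" "?J \<subseteq> I" using fin[OF f] fin[OF g] by auto
    have fJ: "f \<in> ?J \<rightarrow> carrier V" and gJ: "g \<in> ?J \<rightarrow> carrier V" using FV[OF f] FV[OF g] by auto
    have eq: "f \<oplus>\<^bsub>?D\<^esub> g = (\<lambda>i\<in>I. f i \<oplus>\<^bsub>V\<^esub> g i)" by simp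
    have "dsum_sum I V (f \<oplus>\<^bsub>?D\<^esub> g) = finsum V (\<lambda>i\<in>I. f i \<oplus>\<^bsub>V\<^esub> g i) ?J"
      unfolding dsum_sum_def eq
      using J FV[OF f] FV[OF g] by (intro V.finsum_supported) (auto simp: Pi_def)
    also have "\<dots> = finsum V (\<lambda>i. f i \<oplus>\<^bsub>V\<^esub> g i) ?J"
      using J fJ gJ by (intro V.M.finsum_cong2) (auto simp: Pi_def)
    also have "\<dots> = finsum V f ?J \<oplus>\<^bsub>V\<^esub> finsum V g ?J"
      by (rule V.M.finsum_addf[OF fJ gJ])
    also have "finsum V f ?J = dsum_sum I V f"
      unfolding dsum_sum_def using J FV[OF f] by (intro V.finsum_supported[symmetric]) auto
    also have "finsum V g ?J = dsum_sum I V g"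
      unfolding dsum_sum_def using J FV[OF g] by (intro V.finsum_supported[symmetric]) auto
    finally show ?thesis .
  qed
  have smult: "dsum_sum I V (c \<odot>\<^bsub>?D\<^esub> f) = c \<odot>\<^bsub>V\<^esub> dsum_sum I V f"
    if f: "f \<in> carrier ?D" and c: "c \<in> carrier K" for c f
  proof -
    let ?J = "{i \<in> I. f i \<noteq> \<zero>\<^bsub>V\<^esub>}"
    have fJ: "f \<in> ?J \<rightarrow> carrier V" using FV[OF f] by auto
    have eq: "c \<odot>\<^bsub>?D\<^esub> f = (\<lambda>i\<in>I. c \<odot>\<^bsub>V\<^esub> f i)" by simp
    have "dsum_sum I V (c \<odot>\<^bsub>?D\<^esub> f) = finsum V (\<lambda>i\<in>I. c \<odot>\<^bsub>V\<^esub> f i) ?J"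
      unfolding dsum_sum_def eq
      using fin[OF f] FV[OF f] c by (intro V.finsum_supported) (auto simp: Pi_def)
    also have "\<dots> = finsum V (\<lambda>i. c \<odot>\<^bsub>V\<^esub> f i) ?J"
      using fJ c by (intro V.M.finsum_cong2) (auto simp: Pi_def)
    also have "\<dots> = c \<odot>\<^bsub>V\<^esub> dsum_sum I V f"
      unfolding dsum_sum_def using fin[OF f] fJ c by (intro V.finsum_smult_ldistr[symmetric]) auto
    finally show ?thesis .
  qed
  have "dsum_sum I V f \<in> carrier V" if "f \<in> carrier ?D" for f
    unfolding dsum_sum_def using FV[OF that] by (intro V.M.finsum_closed) auto
  then have "dsum_sum I V \<in> LinearCombinations.module_hom K ?D V"
    using add smult unfolding LinearCombinations.module_hom_def by blast
  then show ?thesis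
    using D V by (intro linear_map.intro mod_hom.intro mod_hom_axioms.intro vectorspace.axioms)
qed

text \<open>
  Since \<open>l\<close> is injective on \<open>B\<close>, every \<open>F i\<close> is zero or a line spanned by one basis vector, so that
  a finitely supported family amounts to a finite linear combination of \<open>B\<close>.
\<close>

lemma dsum_sum_bij:
  assumes V: "vectorspace K V" and B: "vectorspace.basis K V B" and lab: "inj_on l B" "l ` B \<subseteq> I"
  defines "F \<equiv> \<lambda>i. LinearCombinations.module.span K V {b \<in> B. l b = i}"
  shows "bij_betw (dsum_sum I V) (carrier (module_dsum I (\<lambda>i. V\<lparr>carrier := F i\<rparr>))) (carrier V)"
proof -
  interpret V: vectorspace K V by fact
  let ?D = "module_dsum I (\<lambda>i. V\<lparr>carrier := F i\<rparr>)"
  have BV: "B \<subseteq> carrier V" and li: "V.lin_indpt B" and gen: "V.span B = carrier V"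
    using B by (auto simp: V.basis_def)
  have blockV: "{b \<in> B. l b = i} \<subseteq> carrier V" for i using BV by blast
  have F: "submodule K (F i) V" for i
    unfolding F_def by (rule V.span_is_submodule[OF blockV])
  interpret S: linear_map K ?D V "dsum_sum I V"
    by (rule dsum_sum_linear[OF V F])
  have FV: "f \<in> I \<rightarrow> carrier V" if "f \<in> carrier ?D" for f
    using that submodule.subset[OF F] by (auto simp: PiE_iff)
  have "inj_on (dsum_sum I V) (carrier ?D)"
  proof (rule S.inj_on_if_ker_trivial[OF S.V.carrier_submodule])
    fix f assume f: "f \<in> carrier ?D" "dsum_sum I V f = \<zero>\<^bsub>V\<^esub>"
    define J where "J = {i \<in> I. f i \<noteq> \<zero>\<^bsub>V\<^esub>}"
    have finJ: "finite J" using f(1) by (simp add: J_def)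
    have "\<exists>b c. b \<in> B \<and> l b = i \<and> c \<in> carrier K \<and> f i = c \<odot>\<^bsub>V\<^esub> b" if i: "i \<in> J" for i
    proof -
      have fi: "f i \<in> F i" "f i \<noteq> \<zero>\<^bsub>V\<^esub>" using f(1) i by (auto simp: J_def)
      have "{b \<in> B. l b = i} \<noteq> {}"
      proof
        assume "{b \<in> B. l b = i} = {}"
        then have "F i = {\<zero>\<^bsub>V\<^esub>}" by (simp only: F_def V.span_empty)
        then show False using fi by blast
      qed
      then obtain b where b: "b \<in> B" "l b = i" by blast
      then have "{b \<in> B. l b = i} = {b}" using lab(1) by (auto simp: inj_on_def)
      then have "f i \<in> V.span {b}" using fi(1) by (simp add: F_def)
      then show ?thesis using V.span_singleton[of b] b BV by blast
    qed
    then obtain b c where bc: "\<And>i. i \<in> J \<Longrightarrow> b i \<in> B \<and> l (b i) = i \<and> c i \<in> carrier K \<and> f i = c i \<odot>\<^bsub>V\<^esub> b i"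
      by metis
    have injb: "inj_on b J" using bc by (metis inj_onI)
    have "V.lincomb (c \<circ> l) (b ` J) = (\<Oplus>\<^bsub>V\<^esub>i\<in>J. (c \<circ> l) (b i) \<odot>\<^bsub>V\<^esub> b i)"
      unfolding V.lincomb_def using bc BV injb by (intro V.M.finsum_reindex) (auto simp: Pi_def subset_iff)
    also have "\<dots> = finsum V f J"
      using bc FV[OF f(1)] by (intro V.M.finsum_cong2) (auto simp: J_def)
    also have "\<dots> = \<zero>\<^bsub>V\<^esub>" using f(2) by (simp add: dsum_sum_def J_def)
    finally have "c \<circ> l \<in> b ` J \<rightarrow> {\<zero>\<^bsub>K\<^esub>}"
      using bc finJ by (intro V.not_lindepD[OF li]) auto
    then have "c (l (b i)) = \<zero>\<^bsub>K\<^esub>" if "i \<in> J" for i using that by (auto simp: Pi_def)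
    then have "f i = \<zero>\<^bsub>V\<^esub>" if "i \<in> J" for i
      using bc[OF that] BV that V.smult_l_null[of "b i"] by (metis subsetD)
    then have "f i = \<zero>\<^bsub>V\<^esub>" if "i \<in> I" for i using that by (auto simp: J_def)
    then show "f = \<zero>\<^bsub>?D\<^esub>" using f(1) by (auto simp: PiE_iff extensional_def fun_eq_iff)
  qed
  moreover have "dsum_sum I V ` carrier ?D = carrier V"
  proof
    show "dsum_sum I V ` carrier ?D \<subseteq> carrier V" using S.f_im by blast
    show "carrier V \<subseteq> dsum_sum I V ` carrier ?D"
    proof
      fix v assume "v \<in> carrier V"
      then have "v \<in> V.span B" using gen by simp
      then obtain a A where A: "finite A" "A \<subseteq> B" "a \<in> A \<rightarrow> carrier K" "v = V.lincomb a A"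
        unfolding V.span_def by blast
      have injA: "inj_on l A" using lab(1) A(2) by (rule inj_on_subset)
      define f where "f = (\<lambda>i\<in>I. if i \<in> l ` A then a (the_inv_into A l i) \<odot>\<^bsub>V\<^esub> the_inv_into A l i else \<zero>\<^bsub>V\<^esub>)"
      have fA: "f (l b) = a b \<odot>\<^bsub>V\<^esub> b" if "b \<in> A" for b
        using that A(2) lab(2) the_inv_into_f_f[OF injA] by (auto simp: f_def)
      have f0: "f i = \<zero>\<^bsub>V\<^esub>" if "i \<in> I - l ` A" for i using that by (simp add: f_def)
      have fF: "f i \<in> F i" if "i \<in> I" for i
      proof (cases "i \<in> l ` A")
        case True
        then obtain b where b: "b \<in> A" "i = l b" by blast
        have "b \<in> F i" using V.in_own_span[OF blockV[of i]] b A(2) by (auto simp: F_def)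
        then show ?thesis
          using submodule.smult_closed[OF F[of i], of "a b" b] fA[OF b(1)] b A(3) by auto
      next
        case False
        then show ?thesis using f0[of i] submodule.zero_closed[OF F] that by simp
      qed
      have supp: "{i \<in> I. f i \<noteq> \<zero>\<^bsub>V\<^esub>} \<subseteq> l ` A" using f0 by blast
      then have "finite {i \<in> I. f i \<noteq> \<zero>\<^bsub>V\<^esub>}" using A(1) finite_surj by blast
      then have fD: "f \<in> carrier ?D" using fF by (auto simp: f_def)
      have "dsum_sum I V f = finsum V f (l ` A)"
        unfolding dsum_sum_def using A lab(2) supp FV[OF fD] by (intro V.finsum_supported) auto
      also have "\<dots> = (\<Oplus>\<^bsub>V\<^esub>b\<in>A. f (l b))"
        using FV[OF fD] injA A(2) lab(2) by (intro V.M.finsum_reindex) auto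
      also have "\<dots> = v"
        unfolding A(4) V.lincomb_def using fA A BV by (intro V.M.finsum_cong2) (auto simp: Pi_def subset_iff)
      finally show "v \<in> dsum_sum I V ` carrier ?D" using fD by blast
    qed
  qed
  ultimately show ?thesis by (simp add: bij_betw_def)
qed

lemma single_in_module_dsum:
  assumes G: "\<And>i. i \<in> I \<Longrightarrow> vectorspace K (G i)" and g: "g \<in> carrier (G i)"
  shows "(\<lambda>j\<in>I. if j = i then g else \<zero>\<^bsub>G j\<^esub>) \<in> carrier (module_dsum I G)" (is "?h \<in> _")
proof -
  have "\<zero>\<^bsub>G j\<^esub> \<in> carrier (G j)" if "j \<in> I" for j
  proof -
    interpret vectorspace K "G j" by (rule G[OF that])
    show ?thesis by (rule M.zero_closed)
  qed
  moreover have "finite {j \<in> I. ?h j \<noteq> \<zero>\<^bsub>G j\<^esub>}"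
    by (rule finite_subset[of _ "{i}"]) auto
  ultimately show ?thesis using g by auto
qed

text \<open>
  A surjection onto a direct sum cannot have a zero component at a nonzero summand, and a
  component that vanishes on a spanning set is zero.
\<close>

lemma dsum_iso_component_nonzero:
  assumes T: "linear_map K V (module_dsum I G) T" and bij: "bij_betw T (carrier V) (carrier (module_dsum I G))"
    and G: "\<And>i. i \<in> I \<Longrightarrow> vectorspace K (G i)" and S: "S \<subseteq> carrier V" "LinearCombinations.module.span K V S = carrier V"
    and i: "i \<in> I" "carrier (G i) \<noteq> {\<zero>\<^bsub>G i\<^esub>}"
  shows "\<exists>b\<in>S. T b i \<noteq> \<zero>\<^bsub>G i\<^esub>"
proof (rule ccontr)
  interpret linear_map K V "module_dsum I G" T by fact
  interpret Gi: vectorspace K "G i" using G i by blast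
  assume "\<not> (\<exists>b\<in>S. T b i \<noteq> \<zero>\<^bsub>G i\<^esub>)"
  then have "S \<subseteq> {v \<in> carrier V. T v i = \<zero>\<^bsub>G i\<^esub>}" using S by blast
  moreover have "submodule K {v \<in> carrier V. T v i = \<zero>\<^bsub>G i\<^esub>} V"
    by (rule submodule.intro[OF vectorspace.axioms(1)[OF V.vectorspace_axioms]]) (use i in auto)
  ultimately have zero: "T v i = \<zero>\<^bsub>G i\<^esub>" if "v \<in> carrier V" for v
    using V.module.span_is_subset S(2) that by blast
  obtain g where g: "g \<in> carrier (G i)" "g \<noteq> \<zero>\<^bsub>G i\<^esub>" using i Gi.M.zero_closed by blast
  define h where "h = (\<lambda>j\<in>I. if j = i then g else \<zero>\<^bsub>G j\<^esub>)"
  have "h \<in> carrier (module_dsum I G)" unfolding h_def by (rule single_in_module_dsum[where G = G and i = i, OF G g(1)])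
  then obtain v where "v \<in> carrier V" "h = T v" using bij_betw_imp_surj_on[OF bij] by blast
  moreover have "h i = g" using i(1) by (simp add: h_def)
  ultimately show False using zero[of v] g(2) by simp
qed

text \<open>
  If \<open>T b\<close> had two nonzero components, then the family that keeps only one of them would not be a
  multiple of \<open>T b\<close>.
\<close>

lemma dsum_iso_line_component_unique:
  assumes T: "linear_map K V (module_dsum I G) T" and bij: "bij_betw T (carrier V) (carrier (module_dsum I G))"
    and G: "\<And>i. i \<in> I \<Longrightarrow> vectorspace K (G i)"
    and b: "b \<in> carrier V" "LinearCombinations.module.span K V {b} = carrier V"
    and ij: "i \<in> I" "j \<in> I" "T b i \<noteq> \<zero>\<^bsub>G i\<^esub>" "T b j \<noteq> \<zero>\<^bsub>G j\<^esub>"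
  shows "i = j"
proof (rule ccontr)
  interpret linear_map K V "module_dsum I G" T by fact
  interpret Gi: vectorspace K "G i" using G ij by blast
  interpret Gj: vectorspace K "G j" using G ij by blast
  assume neq: "i \<noteq> j"
  have Tb: "T b \<in> carrier (module_dsum I G)" by (rule f_im[OF b(1)])
  define h where "h = (\<lambda>k\<in>I. if k = i then T b i else \<zero>\<^bsub>G k\<^esub>)"
  have Tbi: "T b k \<in> carrier (G k)" if "k \<in> I" for k using Tb that by auto
  have "h \<in> carrier (module_dsum I G)" unfolding h_def by (rule single_in_module_dsum[where G = G and i = i, OF G Tbi[OF ij(1)]])
  then obtain v where v: "v \<in> carrier V" "h = T v" using bij_betw_imp_surj_on[OF bij] by blast
  then obtain c where c: "c \<in> carrier K" "v = c \<odot>\<^bsub>V\<^esub> b" using V.span_singleton[OF b(1)] b(2) by blast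
  then have h: "h k = c \<odot>\<^bsub>G k\<^esub> T b k" if "k \<in> I" for k using v b that by simp
  have "c \<odot>\<^bsub>G j\<^esub> T b j = \<zero>\<^bsub>G j\<^esub>" using h[OF ij(2)] neq ij by (simp add: h_def)
  then have "c = \<zero>\<^bsub>K\<^esub>" using Gj.smult_eq_zero[OF c(1) Tbi[OF ij(2)]] ij(4) by blast
  then have "h i = \<zero>\<^bsub>G i\<^esub>" using h[OF ij(1)] Gi.smult_l_null[OF Tbi[OF ij(1)]] by simp
  then show False using ij by (simp add: h_def)
qed

section \<open>The thin summands\<close>

lemma (in mod_hom) hom_finsum:
  assumes "finite A" "g \<in> A \<rightarrow> carrier M"
  shows "f (finsum M g A) = (\<Oplus>\<^bsub>N\<^esub>a\<in>A. f (g a))"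
  using assms
proof (induction A rule: finite_induct)
  case (insert a A)
  then have "f (finsum M g (insert a A)) = f (g a) \<oplus>\<^bsub>N\<^esub> f (finsum M g A)"
    using M.M.finsum_closed[of g A] by (simp add: Pi_def)
  also have "\<dots> = (\<Oplus>\<^bsub>N\<^esub>a\<in>insert a A. f (g a))"
    using insert by (subst N.M.finsum_insert) (auto simp: Pi_def)
  finally show ?case .
qed simp

context labelled_bases
begin

definition block :: "'i \<Rightarrow> 'q0 \<Rightarrow> 'a set" where
  "block i x = {b \<in> \<B> x. lab x b = i}"

text \<open>
  The spaces keep the operations of \<open>M\<close>, so that the summand is a subrepresentation of \<open>M\<close>.
\<close>

definition summand :: "'i \<Rightarrow> ('q0, 'q1, 'k, 'a) quiver_rep" where
  "summand i = \<lparr>vspace = \<lambda>x. (vspace M x)\<lparr>carrier := LinearCombinations.module.span K (vspace M x) (block i x)\<rparr>,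
                vmap = vmap M\<rparr>"

lemma vs: "x \<in> verts Q \<Longrightarrow> vectorspace K (vspace M x)"
  using rep by (simp add: is_rep_def)

lemma lin: "\<alpha> \<in> arcs Q \<Longrightarrow> linear_map K (vspace M (tail Q \<alpha>)) (vspace M (head Q \<alpha>)) (vmap M \<alpha>)"
  using rep by (simp add: is_rep_def)

lemma ends: "\<alpha> \<in> arcs Q \<Longrightarrow> tail Q \<alpha> \<in> verts Q" "\<alpha> \<in> arcs Q \<Longrightarrow> head Q \<alpha> \<in> verts Q"
  using wf by (simp_all add: wf_digraph_def)

lemma \<B>_carrier: "x \<in> verts Q \<Longrightarrow> \<B> x \<subseteq> carrier (vspace M x)"
  using basis[of x] vectorspace.basis_def[OF vs, of x "\<B> x"] by simp

lemma block_carrier: "x \<in> verts Q \<Longrightarrow> block i x \<subseteq> carrier (vspace M x)"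
  using \<B>_carrier[of x] by (auto simp: block_def)

lemma \<B>_nonzero: "x \<in> verts Q \<Longrightarrow> b \<in> \<B> x \<Longrightarrow> b \<noteq> \<zero>\<^bsub>vspace M x\<^esub>"
  using basis[of x] vectorspace.basis_def[OF vs, of x "\<B> x"] vectorspace.vs_zero_lin_dep[OF vs, of x "\<B> x"]
  by auto

lemma block_le_one: "x \<in> verts Q \<Longrightarrow> b \<in> block i x \<Longrightarrow> block i x = {b}"
  using lab_inj[of x] by (auto simp: block_def inj_on_def)

lemma block_submodule:
  "x \<in> verts Q \<Longrightarrow> submodule K (LinearCombinations.module.span K (vspace M x) (block i x)) (vspace M x)"
  by (rule module.span_is_submodule[OF vectorspace.axioms(1)[OF vs] block_carrier])

lemma arrow_into_block:
  assumes "\<alpha> \<in> arcs Q" "b \<in> block i (tail Q \<alpha>)" "vmap M \<alpha> b \<noteq> \<zero>\<^bsub>vspace M (head Q \<alpha>)\<^esub>"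
  shows "vmap M \<alpha> b \<in> block i (head Q \<alpha>)"
  using assms matched[of \<alpha>] lab_arrow[of \<alpha> b]
  by (auto simp: block_def bases_matched_def matching_def)

lemma arrow_preserves_span_block:
  assumes \<alpha>: "\<alpha> \<in> arcs Q"
  shows "vmap M \<alpha> ` LinearCombinations.module.span K (vspace M (tail Q \<alpha>)) (block i (tail Q \<alpha>))
    \<subseteq> LinearCombinations.module.span K (vspace M (head Q \<alpha>)) (block i (head Q \<alpha>))"
proof -
  interpret linear_map K "vspace M (tail Q \<alpha>)" "vspace M (head Q \<alpha>)" "vmap M \<alpha>" by (rule lin[OF \<alpha>])
  note sub = block_submodule[OF ends(2)[OF \<alpha>], of i]
  have "vmap M \<alpha> b \<in> W.module.span (block i (head Q \<alpha>))" if "b \<in> block i (tail Q \<alpha>)" for b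
  proof (cases "vmap M \<alpha> b = \<zero>\<^bsub>vspace M (head Q \<alpha>)\<^esub>")
    case True
    then show ?thesis using submodule.zero_closed[OF sub] by simp
  next
    case False
    then show ?thesis
      using arrow_into_block[OF \<alpha> that] W.module.in_own_span[OF block_carrier[OF ends(2)[OF \<alpha>]]] by blast
  qed
  then show ?thesis
    unfolding image_span[OF block_carrier[OF ends(1)[OF \<alpha>]]]
    by (intro W.module.span_is_subset[OF _ sub]) blast
qed

lemma summand_is_rep: "is_rep K Q (summand i)"
  unfolding is_rep_def summand_def
  using vectorspace.submodule_vectorspace[OF vs block_submodule]
    linear_map_restrict[OF lin block_submodule[OF ends(1)] block_submodule[OF ends(2)] arrow_preserves_span_block]
  by simp

lemma summand_span_block:
  assumes x: "x \<in> verts Q"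
  shows "block i x \<subseteq> carrier (vspace (summand i) x)"
    and "LinearCombinations.module.span K (vspace (summand i) x) (block i x) = carrier (vspace (summand i) x)"
proof -
  interpret vectorspace K "vspace M x" by (rule vs[OF x])
  show "block i x \<subseteq> carrier (vspace (summand i) x)"
    using in_own_span[OF block_carrier[OF x]] by (simp add: summand_def)
  show "LinearCombinations.module.span K (vspace (summand i) x) (block i x) = carrier (vspace (summand i) x)"
    using span_li_not_depend(1)[OF in_own_span[OF block_carrier[OF x]] block_submodule[OF x]]
    by (simp add: summand_def)
qed

lemma summand_thin: "thin K Q (summand i)"
  unfolding thin_def
proof
  fix x assume x: "x \<in> verts Q"
  interpret vectorspace K "vspace (summand i) x"
    using summand_is_rep x by (simp add: is_rep_def)
  have "finite (block i x) \<and> card (block i x) \<le> 1"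
  proof (cases "block i x = {}")
    case False
    then obtain b where "block i x = {b}" using block_le_one[OF x] by blast
    then show ?thesis by simp
  qed simp
  then show "fin_dim \<and> dim \<le> 1"
    using gen_ge_dim[OF _ summand_span_block[OF x]] summand_span_block[OF x] le_trans
    unfolding fin_dim_def by blast
qed

text \<open>
  At a vertex of the string, the summand is a line, so an isomorphism to a direct sum of two
  representations sends its basis vector to a vector with exactly one nonzero component. Links
  of the string preserve which component that is, since the maps of a direct sum act
  componentwise. By connectedness it is the same one along the whole string, and the other
  representation is zero.
\<close>

lemma summand_indecomposable:
  assumes x0: "x0 \<in> verts Q" and b0: "b0 \<in> block i x0"
  shows "indecomposable K Q (summand i)"
  unfolding indecomposable_def
proof (intro conjI notI)
  have "b0 \<in> carrier (vspace (summand i) x0)" using summand_span_block(1)[OF x0] b0 by blast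
  moreover have "b0 \<noteq> \<zero>\<^bsub>vspace (summand i) x0\<^esub>"
    using \<B>_nonzero[OF x0] b0 by (simp add: summand_def block_def)
  ultimately show "nonzero_rep Q (summand i)" using x0 by (auto simp: nonzero_rep_def)
next
  assume "\<exists>N1 N2 :: ('q0, 'q1, 'k, 'a) quiver_rep.
    is_rep K Q N1 \<and> is_rep K Q N2 \<and> nonzero_rep Q N1 \<and> nonzero_rep Q N2 \<and>
    rep_iso K Q (summand i) (rep_dsum UNIV (case_bool N1 N2))"
  then obtain N1 N2 :: "('q0, 'q1, 'k, 'a) quiver_rep" where "is_rep K Q N1" "is_rep K Q N2"
    and nz: "nonzero_rep Q N1" "nonzero_rep Q N2"
    and iso: "rep_iso K Q (summand i) (rep_dsum UNIV (case_bool N1 N2))" by blast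
  define N where "N = case_bool N1 N2"
  have N: "is_rep K Q (N t)" "nonzero_rep Q (N t)" for t
    using nz \<open>is_rep K Q N1\<close> \<open>is_rep K Q N2\<close> by (cases t; simp add: N_def)+
  obtain \<phi> where "\<forall>x\<in>verts Q. linear_map K (vspace (summand i) x) (vspace (rep_dsum UNIV N) x) (\<phi> x) \<and>
      bij_betw (\<phi> x) (carrier (vspace (summand i) x)) (carrier (vspace (rep_dsum UNIV N) x))"
    and comm: "\<forall>\<alpha>\<in>arcs Q. \<forall>v\<in>carrier (vspace (summand i) (tail Q \<alpha>)).
      \<phi> (head Q \<alpha>) (vmap (summand i) \<alpha> v) = vmap (rep_dsum UNIV N) \<alpha> (\<phi> (tail Q \<alpha>) v)"
    using iso unfolding rep_iso_def N_def by blast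
  then have \<phi>: "linear_map K (vspace (summand i) x) (module_dsum UNIV (\<lambda>t. vspace (N t) x)) (\<phi> x)"
    and bij: "bij_betw (\<phi> x) (carrier (vspace (summand i) x)) (carrier (module_dsum UNIV (\<lambda>t. vspace (N t) x)))"
    if "x \<in> verts Q" for x
    using that unfolding rep_dsum_def quiver_rep.simps by blast+
  have Nvs: "vectorspace K (vspace (N t) x)" if "x \<in> verts Q" for x t
    using N(1)[of t] that by (simp add: is_rep_def)
  have unique: "s = t" if x: "x \<in> verts Q" and b: "b \<in> block i x"
      and nonzero: "\<phi> x b s \<noteq> \<zero>\<^bsub>vspace (N s) x\<^esub>" "\<phi> x b t \<noteq> \<zero>\<^bsub>vspace (N t) x\<^esub>" for x b s t
  proof (rule dsum_iso_line_component_unique[OF \<phi>[OF x] bij[OF x] Nvs[OF x] _ _ _ _ nonzero])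
    show "b \<in> carrier (vspace (summand i) x)" using summand_span_block(1)[OF x] b by blast
    show "LinearCombinations.module.span K (vspace (summand i) x) {b} = carrier (vspace (summand i) x)"
      using summand_span_block(2)[OF x, of i] unfolding block_le_one[OF x b] .
  qed simp_all
  have reached: "\<exists>x\<in>verts Q. \<exists>b\<in>block i x. \<phi> x b t \<noteq> \<zero>\<^bsub>vspace (N t) x\<^esub>" for t
  proof -
    obtain x where x: "x \<in> verts Q" "carrier (vspace (N t) x) \<noteq> {\<zero>\<^bsub>vspace (N t) x\<^esub>}"
      using N(2)[of t] by (auto simp: nonzero_rep_def)
    then show ?thesis
      using dsum_iso_component_nonzero[OF \<phi>[OF x(1)] bij[OF x(1)] Nvs[OF x(1)] summand_span_block[OF x(1)] UNIV_I] by blast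
  qed
  have step: "\<phi> (tail Q \<alpha>) b t \<noteq> \<zero>\<^bsub>vspace (N t) (tail Q \<alpha>)\<^esub>"
    if \<alpha>: "\<alpha> \<in> arcs Q" and b: "b \<in> block i (tail Q \<alpha>)"
      and nonzero: "\<phi> (head Q \<alpha>) (vmap M \<alpha> b) t \<noteq> \<zero>\<^bsub>vspace (N t) (head Q \<alpha>)\<^esub>" for \<alpha> b t
  proof
    assume zero: "\<phi> (tail Q \<alpha>) b t = \<zero>\<^bsub>vspace (N t) (tail Q \<alpha>)\<^esub>"
    interpret linear_map K "vspace (N t) (tail Q \<alpha>)" "vspace (N t) (head Q \<alpha>)" "vmap (N t) \<alpha>"
      using N(1)[of t] \<alpha> by (simp add: is_rep_def)
    have "b \<in> carrier (vspace (summand i) (tail Q \<alpha>))" using summand_span_block(1)[OF ends(1)[OF \<alpha>]] b by blast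
    then have "\<phi> (head Q \<alpha>) (vmap M \<alpha> b) t = vmap (N t) \<alpha> (\<phi> (tail Q \<alpha>) b t)"
      using comm \<alpha> by (simp add: summand_def rep_dsum_def)
    then show False using nonzero zero by simp
  qed
  \<comment> \<open>Constancy along arrows is needed on all strings; \<open>P\<close> is made false off the string \<open>i\<close>.\<close>
  define P where "P x b \<longleftrightarrow> lab x b = i \<and> \<phi> x b True \<noteq> \<zero>\<^bsub>vspace (N True) x\<^esub>" for x b
  have P_arrow: "P (tail Q \<alpha>) b = P (head Q \<alpha>) (vmap M \<alpha> b)"
    if \<alpha>: "\<alpha> \<in> arcs Q" and b: "b \<in> \<B> (tail Q \<alpha>)" "vmap M \<alpha> b \<noteq> \<zero>\<^bsub>vspace M (head Q \<alpha>)\<^esub>" for \<alpha> b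
  proof (cases "lab (tail Q \<alpha>) b = i")
    case True
    then have blk: "b \<in> block i (tail Q \<alpha>)" using b by (simp add: block_def)
    note blk' = arrow_into_block[OF \<alpha> blk b(2)]
    have "\<exists>t. \<phi> (head Q \<alpha>) (vmap M \<alpha> b) t \<noteq> \<zero>\<^bsub>vspace (N t) (head Q \<alpha>)\<^esub>"
    proof (rule ccontr)
      assume "\<not> (\<exists>t. \<phi> (head Q \<alpha>) (vmap M \<alpha> b) t \<noteq> \<zero>\<^bsub>vspace (N t) (head Q \<alpha>)\<^esub>)"
      then have zero: "\<phi> (head Q \<alpha>) (vmap M \<alpha> b) = \<zero>\<^bsub>module_dsum UNIV (\<lambda>t. vspace (N t) (head Q \<alpha>))\<^esub>"
        by (auto simp: fun_eq_iff)
      interpret linear_map K "vspace (summand i) (head Q \<alpha>)" "module_dsum UNIV (\<lambda>t. vspace (N t) (head Q \<alpha>))" "\<phi> (head Q \<alpha>)"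
        by (rule \<phi>[OF ends(2)[OF \<alpha>]])
      have "vmap M \<alpha> b = \<zero>\<^bsub>vspace (summand i) (head Q \<alpha>)\<^esub>"
      proof (rule inj_onD[OF bij_betw_imp_inj_on[OF bij[OF ends(2)[OF \<alpha>]]]])
        show "\<phi> (head Q \<alpha>) (vmap M \<alpha> b) = \<phi> (head Q \<alpha>) \<zero>\<^bsub>vspace (summand i) (head Q \<alpha>)\<^esub>"
          unfolding zero f0_is_0 ..
        show "vmap M \<alpha> b \<in> carrier (vspace (summand i) (head Q \<alpha>))"
          using blk' summand_span_block(1)[OF ends(2)[OF \<alpha>], of i] by blast
        show "\<zero>\<^bsub>vspace (summand i) (head Q \<alpha>)\<^esub> \<in> carrier (vspace (summand i) (head Q \<alpha>))"
          by (rule V.module.M.zero_closed)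
      qed
      then show False using b(2) by (simp add: summand_def)
    qed
    then obtain t where t: "\<phi> (head Q \<alpha>) (vmap M \<alpha> b) t \<noteq> \<zero>\<^bsub>vspace (N t) (head Q \<alpha>)\<^esub>" by blast
    note t' = step[OF \<alpha> blk t]
    have "P (head Q \<alpha>) (vmap M \<alpha> b) \<longleftrightarrow> t = True"
      using unique[OF ends(2)[OF \<alpha>] blk' t, of True] blk' t by (auto simp: P_def block_def)
    moreover have "P (tail Q \<alpha>) b \<longleftrightarrow> t = True"
      using unique[OF ends(1)[OF \<alpha>] blk t', of True] blk t' by (auto simp: P_def block_def)
    ultimately show ?thesis by blast
  next
    case False
    then show ?thesis using lab_arrow[OF \<alpha> b] by (simp add: P_def)
  qed
  obtain x b where x: "x \<in> verts Q" "b \<in> block i x" "\<phi> x b True \<noteq> \<zero>\<^bsub>vspace (N True) x\<^esub>"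
    using reached[of True] by blast
  obtain y c where y: "y \<in> verts Q" "c \<in> block i y" "\<phi> y c False \<noteq> \<zero>\<^bsub>vspace (N False) y\<^esub>"
    using reached[of False] by blast
  have "P x b \<longleftrightarrow> P y c"
    using x y by (intro lab_connected[OF P_arrow]) (auto simp: block_def)
  moreover have "P x b" using x by (simp add: P_def block_def)
  ultimately have "\<phi> y c True \<noteq> \<zero>\<^bsub>vspace (N True) y\<^esub>" by (simp add: P_def)
  then show False using unique[OF y(1,2) _ y(3), of True] by simp
qed

text \<open>
  At every vertex, \<^const>\<open>dsum_sum\<close> identifies the direct sum of the lines spanned by the basis
  vectors with \<open>M\<close>. These maps commute with the arrows because the maps of \<open>M\<close> are additive; the
  required isomorphism consists of their inverses.
\<close>

lemma decomposition:
  assumes I: "\<And>x b. x \<in> verts Q \<Longrightarrow> b \<in> \<B> x \<Longrightarrow> lab x b \<in> I"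
  shows "rep_iso K Q M (rep_dsum I summand)"
proof -
  let ?D = "\<lambda>x. module_dsum I (\<lambda>i. vspace (summand i) x)"
  define \<psi> where "\<psi> x = dsum_sum I (vspace M x)" for x
  have \<psi>: "linear_map K (?D x) (vspace M x) (\<psi> x)"
    and bij: "bij_betw (\<psi> x) (carrier (?D x)) (carrier (vspace M x))" if x: "x \<in> verts Q" for x
  proof -
    show "linear_map K (?D x) (vspace M x) (\<psi> x)"
      unfolding \<psi>_def summand_def quiver_rep.simps by (rule dsum_sum_linear[OF vs[OF x] block_submodule[OF x]])
    show "bij_betw (\<psi> x) (carrier (?D x)) (carrier (vspace M x))"
      unfolding \<psi>_def summand_def quiver_rep.simps block_def
      using I[OF x] by (intro dsum_sum_bij[OF vs[OF x] basis[OF x] lab_inj[OF x]]) blast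
  qed
  have natural: "\<psi> (head Q \<alpha>) (vmap (rep_dsum I summand) \<alpha> f) = vmap M \<alpha> (\<psi> (tail Q \<alpha>) f)"
    and natural_in: "vmap (rep_dsum I summand) \<alpha> f \<in> carrier (?D (head Q \<alpha>))"
    if \<alpha>: "\<alpha> \<in> arcs Q" and f: "f \<in> carrier (?D (tail Q \<alpha>))" for \<alpha> f
  proof -
    interpret linear_map K "vspace M (tail Q \<alpha>)" "vspace M (head Q \<alpha>)" "vmap M \<alpha>" by (rule lin[OF \<alpha>])
    define J where "J = {i \<in> I. f i \<noteq> \<zero>\<^bsub>vspace M (tail Q \<alpha>)\<^esub>}"
    have finJ: "finite J" using f by (simp add: J_def summand_def)
    have fV: "f \<in> I \<rightarrow> carrier (vspace M (tail Q \<alpha>))"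
      using f submodule.subset[OF block_submodule[OF ends(1)[OF \<alpha>]]] by (auto simp: summand_def PiE_iff)
    have g: "vmap (rep_dsum I summand) \<alpha> f = (\<lambda>i\<in>I. vmap M \<alpha> (f i))"
      by (simp add: rep_dsum_def summand_def)
    have supp: "{i \<in> I. (\<lambda>i\<in>I. vmap M \<alpha> (f i)) i \<noteq> \<zero>\<^bsub>vspace M (head Q \<alpha>)\<^esub>} \<subseteq> J"
      by (auto simp: J_def)
    have "\<psi> (head Q \<alpha>) (vmap (rep_dsum I summand) \<alpha> f) = finsum (vspace M (head Q \<alpha>)) (\<lambda>i\<in>I. vmap M \<alpha> (f i)) J"
      unfolding \<psi>_def g dsum_sum_def using finJ supp fV f_im by (intro W.finsum_supported) (auto simp: J_def Pi_def)
    also have "\<dots> = (\<Oplus>\<^bsub>vspace M (head Q \<alpha>)\<^esub>i\<in>J. vmap M \<alpha> (f i))"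
      using fV f_im by (intro W.module.M.finsum_cong2) (auto simp: J_def Pi_def)
    also have "\<dots> = vmap M \<alpha> (\<psi> (tail Q \<alpha>) f)"
      unfolding \<psi>_def dsum_sum_def J_def[symmetric] using finJ fV
      by (intro hom_finsum[symmetric]) (auto simp: J_def)
    finally show "\<psi> (head Q \<alpha>) (vmap (rep_dsum I summand) \<alpha> f) = vmap M \<alpha> (\<psi> (tail Q \<alpha>) f)" .
    interpret D: linear_map K "?D (tail Q \<alpha>)" "?D (head Q \<alpha>)" "vmap (rep_dsum I summand) \<alpha>"
      using is_rep_dsum[OF fieldK wf summand_is_rep, of I] \<alpha> by (simp add: is_rep_def rep_dsum_def)
    show "vmap (rep_dsum I summand) \<alpha> f \<in> carrier (?D (head Q \<alpha>))" by (rule D.f_im[OF f])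
  qed
  define \<phi> where "\<phi> x = the_inv_into (carrier (?D x)) (\<psi> x)" for x
  have "linear_map K (vspace M x) (?D x) (\<phi> x)" "bij_betw (\<phi> x) (carrier (vspace M x)) (carrier (?D x))"
    if "x \<in> verts Q" for x
    unfolding \<phi>_def using linear_map_inverse[OF \<psi> bij] bij_betw_the_inv_into[OF bij] that by blast+
  moreover have "\<phi> (head Q \<alpha>) (vmap M \<alpha> v) = vmap (rep_dsum I summand) \<alpha> (\<phi> (tail Q \<alpha>) v)"
    if \<alpha>: "\<alpha> \<in> arcs Q" and v: "v \<in> carrier (vspace M (tail Q \<alpha>))" for \<alpha> v
  proof -
    obtain f where f: "f \<in> carrier (?D (tail Q \<alpha>))" "v = \<psi> (tail Q \<alpha>) f"
      using bij_betw_imp_surj_on[OF bij[OF ends(1)[OF \<alpha>]]] v by blast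
    have "\<phi> (tail Q \<alpha>) v = f"
      unfolding \<phi>_def f(2) by (rule the_inv_into_f_f[OF bij_betw_imp_inj_on[OF bij[OF ends(1)[OF \<alpha>]]] f(1)])
    moreover have "\<phi> (head Q \<alpha>) (vmap M \<alpha> v) = vmap (rep_dsum I summand) \<alpha> f"
      unfolding \<phi>_def f(2) natural[OF \<alpha> f(1), symmetric]
      by (rule the_inv_into_f_f[OF bij_betw_imp_inj_on[OF bij[OF ends(2)[OF \<alpha>]]] natural_in[OF \<alpha> f(1)]])
    ultimately show ?thesis by simp
  qed
  ultimately show ?thesis
    unfolding rep_iso_def by (intro exI[of _ \<phi>]) (simp add: rep_dsum_def)
qed

end

section \<open>The decomposition theorem\<close>

theorem theorem1p1:
  fixes K :: "('k, 'm) ring_scheme"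
    and n :: nat
    and Q :: "('q0, 'q1) pre_digraph"
    and M :: "('q0, 'q1, 'k, 'a) quiver_rep"
  assumes "field K"
    and "n \<ge> 1"
    and "type_A n Q"
    and "is_rep K Q M"
  shows "\<exists>(I :: ('q0 \<times> 'a) set) (N :: 'q0 \<times> 'a \<Rightarrow> ('q0, 'q1, 'k, 'a) quiver_rep).
           (\<forall>i\<in>I. is_rep K Q (N i) \<and> thin K Q (N i) \<and> indecomposable K Q (N i)) \<and>
           rep_iso K Q M (rep_dsum I N)"
proof -
  obtain \<B> and lab :: "'q0 \<Rightarrow> 'a \<Rightarrow> 'q0 \<times> 'a" where "labelled_bases K Q M \<B> lab"
    using type_A_labelled_bases assms by blast
  then interpret labelled_bases K Q M \<B> lab .
  let ?I = "{lab x b |x b. x \<in> verts Q \<and> b \<in> \<B> x}"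
  have "is_rep K Q (summand i) \<and> thin K Q (summand i) \<and> indecomposable K Q (summand i)" if "i \<in> ?I" for i
    using that summand_is_rep summand_thin summand_indecomposable by (auto simp: block_def)
  moreover have "rep_iso K Q M (rep_dsum ?I summand)" by (rule decomposition) blast
  ultimately show ?thesis by blast
qed

end
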